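(* Let $n\ge 1$, let $b$ be a locally integrable function on $\mathbb{R}^n$ and let $0<\beta<1$. Suppose that $1<p<n/\beta$, $0<\lambda<n-\beta p$ and $1/q=1/p-\beta/(n-\lambda)$. Then the following statements are equivalent: (1) $b\in\dot{\Lambda}_{\beta}(\mathbb{R}^n)$ and $b\ge 0$. (2) The commutator $[b,M]$ is bounded from $L^{p,\lambda}(\mathbb{R}^n)$ to $L^{q,\lambda}(\mathbb{R}^n)$.
   Context: Cubes have sides parallel to the coordinate axes; $|E|$ denotes Lebesgue measure. The Hardy-Littlewood maximal function is $$M(f)(x)=\sup_{Q\ni x}\frac{1}{|Q|}\int_Q|f(y)|\,dy,$$ the supremum being over all cubes $Q\subset\mathbb{R}^n$ containing $x$. For a locally integrable function $b$, the (nonlinear) commutator is $$[b,M](f)(x)=b(x)M(f)(x)-M(bf)(x).$$ "$[b,M]$ is bounded from $X$ to $Y$" means that there is a constant $C$ such that, for all $f\in X$, $[b,M](f)$ is well defined a.e. and $\|[b,M](f)\|_Y\le C\|f\|_X$. For $0<\beta<1$, a function $b$ belongs to the Lipschitz space $\dot{\Lambda}_{\beta}(\mathbb{R}^n)$ if there is a constant $C$ such that $|b(x)-b(y)|\le C|x-y|^{\beta}$ for all $x,y\in\mathbb{R}^n$. As usual, functions are identified if they agree almost everywhere, so for a locally integrable $b$, $b\in\dot{\Lambda}_{\beta}(\mathbb{R}^n)$ means that $b$ agrees a.e. with a function satisfying this condition, and $b\ge0$ is understood a.e. For $1\le p<\infty$ and $0\le\lambda\le n$, the Morrey space is $L^{p,\lambda}(\mathbb{R}^n)=\{f\in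 L^p_{\mathrm{loc}}(\mathbb{R}^n):\|f\|_{L^{p,\lambda}}<\infty\}$, where $$\|f\|_{L^{p,\lambda}}=\sup_Q\bigg(\frac{1}{|Q|^{\lambda/n}}\int_Q|f(x)|^p\,dx\bigg)^{1/p},$$ the supremum being over all cubes $Q\subset\mathbb{R}^n$. *)

theory Defs
  imports "HOL-Analysis.Analysis"
begin

text \<open>Nondegenerate closed cubes with sides parallel to the axes. Closed and open cubes give
  the same suprema below.\<close>

definition cubes :: "'a::euclidean_space set set" where
  "cubes = {cbox a (a + l *\<^sub>R One) | a l. l > 0}"

text \<open>The maximal function, with values in \<open>[0, \<infinity>]\<close>.\<close>

definition hl_max :: "('a::euclidean_space \<Rightarrow> real) \<Rightarrow> 'a \<Rightarrow> ennreal" where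
  "hl_max f x =
     (SUP Q\<in>{Q \<in> cubes. x \<in> Q}. (\<integral>\<^sup>+y\<in>Q. ennreal \<bar>f y\<bar> \<partial>lebesgue) / emeasure lebesgue Q)"

text \<open>The commutator is taken in the extended reals. It is well defined at a point if the
  difference is not of the form \<open>\<infinity> - \<infinity>\<close> there (which \<^typ>\<open>ereal\<close> would evaluate to \<open>\<infinity>\<close>);
  a product \<open>0 * \<infinity>\<close> is \<open>0\<close>, as usual in integration theory.\<close>

definition commutator :: "('a::euclidean_space \<Rightarrow> real) \<Rightarrow> ('a \<Rightarrow> real) \<Rightarrow> 'a \<Rightarrow> ereal" where
  "commutator b f x =
     ereal (b x) * enn2ereal (hl_max f x) - enn2ereal (hl_max (\<lambda>y. b y * f y) x)"

definition commutator_well_defined ::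
    "('a::euclidean_space \<Rightarrow> real) \<Rightarrow> ('a \<Rightarrow> real) \<Rightarrow> 'a \<Rightarrow> bool" where
  "commutator_well_defined b f x \<longleftrightarrow>
     \<not> (ereal (b x) * enn2ereal (hl_max f x) = \<infinity> \<and> hl_max (\<lambda>y. b y * f y) x = \<infinity>)"

definition locally_integrable :: "('a::euclidean_space \<Rightarrow> real) \<Rightarrow> bool" where
  "locally_integrable f \<longleftrightarrow> (\<forall>K. compact K \<longrightarrow> f absolutely_integrable_on K)"

definition lipschitz_space :: "real \<Rightarrow> ('a::euclidean_space \<Rightarrow> real) set" where
  "lipschitz_space \<beta> = {g. \<exists>C. \<forall>x y. \<bar>g x - g y\<bar> \<le> C * norm (x - y) powr \<beta>}"

text \<open>Powers of elements of \<open>[0, \<infinity>]\<close>; only used for exponents \<open>a > 0\<close>.\<close>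

definition enn_powr :: "ennreal \<Rightarrow> real \<Rightarrow> ennreal" where
  "enn_powr x a = (if x = \<infinity> then \<infinity> else ennreal (enn2real x powr a))"

definition morrey_norm :: "real \<Rightarrow> real \<Rightarrow> ('a::euclidean_space \<Rightarrow> ereal) \<Rightarrow> ennreal" where
  "morrey_norm p lam g =
     (SUP Q\<in>cubes. enn_powr
        ((\<integral>\<^sup>+x\<in>Q. enn_powr (e2ennreal \<bar>g x\<bar>) p \<partial>lebesgue)
           / ennreal (measure lebesgue Q powr (lam / DIM('a))))
        (1 / p))"

definition morrey_space :: "real \<Rightarrow> real \<Rightarrow> ('a::euclidean_space \<Rightarrow> real) set" where
  "morrey_space p lam =
     {f \<in> borel_measurable lebesgue.
        locally_integrable (\<lambda>x. \<bar>f x\<bar> powr p) \<and> morrey_norm p lam (\<lambda>x. ereal (f x)) < \<infinity>}"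

definition commutator_bounded ::
    "('a::euclidean_space \<Rightarrow> real) \<Rightarrow> real \<Rightarrow> real \<Rightarrow> real \<Rightarrow> real \<Rightarrow> bool" where
  "commutator_bounded b p lam q mu \<longleftrightarrow>
     (\<exists>C\<ge>0. \<forall>f \<in> morrey_space p lam.
        (AE x in lebesgue. commutator_well_defined b f x) \<and>
        morrey_norm q mu (commutator b f)
          \<le> ennreal C * morrey_norm p lam (\<lambda>x. ereal (f x)))"

end

theory Submission
  imports Defs
begin

text \<open>
  If \<open>b\<close> is nonnegative and Hoelder continuous of order \<open>\<beta>\<close>, then \<open>\<bar>[b,M]f(x)\<bar>\<close> is at most a constant times
  the supremum of \<open>l\<^sup>\<beta>\<close> times the average of \<open>\<bar>f\<bar>\<close> over the cubes of side \<open>l\<close> containing \<open>x\<close>. Such an average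
  is at most \<open>Mf(x)\<close>, and at most a constant times \<open>\<parallel>f\<parallel> l\<close> to the power \<open>(\<lambda> - n) / p\<close>; in the geometric mean
  of these two bounds with weights \<open>p / q\<close> and \<open>1 - p / q\<close> the powers of \<open>l\<close> cancel against \<open>l\<^sup>\<beta>\<close>. Boundedness
  thus reduces to that of \<open>M\<close> on the Morrey space, which follows from the strong type inequality by
  splitting \<open>f\<close> at the cube of triple side.

  Conversely, test the commutator on the indicator of a cube \<open>Q\<close>. On \<open>Q\<close> it is \<open>b - M(b 1\<^sub>Q)\<close>, so its absolute
  value is at least \<open>c - b\<close> for every \<open>c\<close> bounded by the average of \<open>\<bar>b\<bar>\<close> over \<open>Q\<close>. Taking \<open>c = 0\<close> shows that
  the negative part of \<open>b\<close> vanishes; taking \<open>c\<close> to be the average of \<open>b\<close> controls the mean oscillation of \<open>b\<close>,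
  because half of it comes from the part of \<open>Q\<close> where \<open>b\<close> is below its average. Campanato's argument
  then gives Hoelder continuity.
\<close>

section \<open>Cubes, powers and Morrey norms\<close>

abbreviation cube :: "'a::euclidean_space \<Rightarrow> real \<Rightarrow> 'a set" where
  "cube a l \<equiv> cbox a (a + l *\<^sub>R One)"

lemma mem_cube: "x \<in> cube a l \<longleftrightarrow> (\<forall>i\<in>Basis. a \<bullet> i \<le> x \<bullet> i \<and> x \<bullet> i \<le> a \<bullet> i + l)"
  by (simp add: mem_box inner_add_left)

lemma measure_cube: "l \<ge> 0 \<Longrightarrow> measure lebesgue (cube (a::'a::euclidean_space) l) = l ^ DIM('a)"
  by (simp add: measure_lborel_cbox_eq inner_add_left)

lemma emeasure_cube:
  "l \<ge> 0 \<Longrightarrow> emeasure lebesgue (cube (a::'a::euclidean_space) l) = ennreal (l ^ DIM('a))"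
  by (simp add: emeasure_lborel_cbox_eq inner_add_left)

lemma norm_diff_le_cube:
  fixes x y :: "'a::euclidean_space" and l :: real
  assumes "x \<in> cube a l" "y \<in> cube a l"
  shows "norm (x - y) \<le> DIM('a) * l"
proof -
  have "norm (x - y) \<le> (\<Sum>i\<in>Basis. \<bar>(x - y) \<bullet> i\<bar>)"
    by (rule norm_le_l1)
  also have "\<dots> \<le> (\<Sum>i\<in>(Basis::'a set). l)"
    using assms by (intro sum_mono) (force simp: mem_cube inner_diff_left abs_le_iff)
  finally show ?thesis by simp
qed

section \<open>Powers in the extended half-line and Morrey norms\<close>

lemma enn_powr_ennreal: "r \<ge> 0 \<Longrightarrow> enn_powr (ennreal r) a = ennreal (r powr a)"
  by (simp add: enn_powr_def)

lemma enn_powr_top [simp]: "enn_powr top a = top"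
  by (simp add: enn_powr_def)

lemma enn_powr_mono: "a \<ge> 0 \<Longrightarrow> x \<le> y \<Longrightarrow> enn_powr x a \<le> enn_powr y a"
  by (cases x; cases y) (auto simp: enn_powr_ennreal top_unique intro!: powr_mono2)

text \<open>Moves the outer root of the Morrey norm to the other side, so that only integrals of
  powers have to be compared. An infinite \<open>x\<close> fails both inequalities.\<close>

lemma enn_powr_inverse_le_iff:
  assumes "a > 0" "K \<ge> 0"
  shows "enn_powr x (1 / a) \<le> ennreal K \<longleftrightarrow> x \<le> ennreal (K powr a)"
proof (cases x)
  case (real r)
  have "r powr (1 / a) \<le> K \<longleftrightarrow> r \<le> K powr a"
  proof
    assume "r powr (1 / a) \<le> K"
    hence "(r powr (1 / a)) powr a \<le> K powr a"
      using assms by (intro powr_mono2) auto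
    thus "r \<le> K powr a" using assms real by (simp add: powr_powr)
  next
    assume "r \<le> K powr a"
    hence "r powr (1 / a) \<le> (K powr a) powr (1 / a)"
      using assms real by (intro powr_mono2) auto
    thus "r powr (1 / a) \<le> K" using assms real by (simp add: powr_powr)
  qed
  thus ?thesis using real assms by (simp add: enn_powr_ennreal)
qed (simp add: top_unique)

lemma borel_measurable_enn_powr [measurable]:
  assumes [measurable]: "f \<in> borel_measurable M"
  shows "(\<lambda>x. enn_powr (f x) a) \<in> borel_measurable M"
  unfolding enn_powr_def by measurable

lemma enn_powr_max_le:
  assumes "p > 0" shows "enn_powr (max x y) p \<le> enn_powr x p + enn_powr y p"
  by (cases "x \<le> y") (auto simp: max_def intro: order_trans[OF _ add_increasing] add_increasing2)

lemma divide_le_ennreal_iff: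
  assumes "c > 0" shows "x / ennreal c \<le> y \<longleftrightarrow> x \<le> y * ennreal c"
proof
  assume "x / ennreal c \<le> y"
  hence "x / ennreal c * ennreal c \<le> y * ennreal c" by (rule mult_right_mono) simp
  thus "x \<le> y * ennreal c"
    using assms by (simp add: ennreal_divide_times ennreal_times_divide[symmetric] ennreal_mult_divide_eq ennreal_divide_self)
next
  assume "x \<le> y * ennreal c"
  thus "x / ennreal c \<le> y"
    using assms by (intro divide_le_posI_ennreal) (auto simp: mult.commute)
qed

text \<open>All later estimates use the norm in this form, one inequality per cube, free of
  supremum, root and quotient. The normalising factor becomes \<open>l powr lam\<close> because the
  volume is the power \<open>DIM('a)\<close> of the side.\<close>

lemma morrey_norm_le_iff:
  fixes g :: "'a::euclidean_space \<Rightarrow> ereal"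
  assumes "p > 0" "K \<ge> 0"
  shows "morrey_norm p lam g \<le> ennreal K \<longleftrightarrow>
    (\<forall>a l. l > 0 \<longrightarrow> (\<integral>\<^sup>+x\<in>cube a l. enn_powr (e2ennreal \<bar>g x\<bar>) p \<partial>lebesgue)
        \<le> ennreal (K powr p * l powr lam))"
proof -
  have *: "measure lebesgue (cube a l) powr (lam / DIM('a)) = l powr lam" if "l > 0" for a :: 'a and l
    by (subst measure_cube) (use that in \<open>simp_all add: powr_powr flip: powr_realpow\<close>)
  have "(\<forall>Q\<in>cubes. P Q) \<longleftrightarrow> (\<forall>a l. l > 0 \<longrightarrow> P (cube a l))" for P :: "'a set \<Rightarrow> bool"
    by (auto simp: cubes_def)
  thus ?thesis
    unfolding morrey_norm_def SUP_le_iff enn_powr_inverse_le_iff[OF assms]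
    by (simp add: * divide_le_ennreal_iff ennreal_mult'' del: measure_completion)
qed

text \<open>Hoelder's inequality up to the factor 2, from the pointwise bound \<open>u \<le> s + s powr (1 - p) * u powr p\<close>.\<close>

lemma set_nn_integral_le_of_powr:
  fixes u :: "'a \<Rightarrow> ennreal"
  assumes [measurable]: "u \<in> borel_measurable M" "A \<in> sets M"
    and p: "p > 1" and s: "s \<ge> 0" and m: "emeasure M A = ennreal m" "m \<ge> 0"
    and le: "(\<integral>\<^sup>+x\<in>A. enn_powr (u x) p \<partial>M) \<le> ennreal (s powr p * m)"
  shows "(\<integral>\<^sup>+x\<in>A. u x \<partial>M) \<le> ennreal (2 * s * m)"
proof (cases "s = 0")
  \<comment> \<open>The pointwise bound fails here, since \<open>0 powr (1 - p) = 0\<close>; instead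
    the integrand vanishes almost everywhere.\<close>
  case True
  hence "(\<integral>\<^sup>+x\<in>A. enn_powr (u x) p \<partial>M) = 0" using le by simp
  hence "AE x in M. enn_powr (u x) p * indicator A x = 0"
    by (subst (asm) nn_integral_0_iff_AE) auto
  hence "AE x in M. u x * indicator A x = 0"
  proof eventually_elim
    case (elim x)
    thus ?case by (cases "u x") (auto simp: enn_powr_ennreal indicator_def)
  qed
  hence "(\<integral>\<^sup>+x\<in>A. u x \<partial>M) = 0" by (subst nn_integral_0_iff_AE) auto
  thus ?thesis by simp
next
  case False
  hence s: "s > 0" using s by simp
  have *: "u x \<le> ennreal s + ennreal (s powr (1 - p)) * enn_powr (u x) p" for x
  proof (cases "u x")
    case (real r)
    have "r \<le> s + s powr (1 - p) * r powr p"
    proof (cases "r \<le> s")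
      case True thus ?thesis using real by (simp add: add_increasing2)
    next
      case False
      \<comment> \<open>For values above \<open>s\<close>, the power with negative exponent
        \<open>1 - p\<close> is at most its value at \<open>s\<close>.\<close>
      have "r = r powr (1 - p) * r powr p" using False s by (simp flip: powr_add)
      also have "\<dots> \<le> s powr (1 - p) * r powr p"
        using False s p by (intro mult_right_mono powr_mono2') auto
      finally show ?thesis using s by simp
    qed
    thus ?thesis using real s
      by (simp add: enn_powr_ennreal flip: ennreal_mult'' ennreal_plus)
  qed (use s in \<open>simp add: ennreal_mult_top\<close>)
  have "(\<integral>\<^sup>+x\<in>A. u x \<partial>M) \<le>
      (\<integral>\<^sup>+x. ennreal s * indicator A x + ennreal (s powr (1 - p)) * (enn_powr (u x) p * indicator A x) \<partial>M)"
    by (intro nn_integral_mono) (use * in \<open>auto simp: indicator_def\<close>)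
  also have "\<dots> = ennreal s * ennreal m + ennreal (s powr (1 - p)) * (\<integral>\<^sup>+x\<in>A. enn_powr (u x) p \<partial>M)"
    by (subst nn_integral_add) (auto simp: nn_integral_cmult m nn_integral_cmult_indicator)
  also have "\<dots> \<le> ennreal s * ennreal m + ennreal (s powr (1 - p)) * ennreal (s powr p * m)"
    by (intro add_left_mono mult_left_mono le) auto
  also have "\<dots> = ennreal (s * m + s powr (1 - p) * (s powr p * m))"
    using s m by (simp add: ennreal_mult ennreal_plus)
  also have "s * m + s powr (1 - p) * (s powr p * m) = 2 * s * m"
    using s by (simp add: mult.assoc[symmetric] flip: powr_add)
  finally show ?thesis .
qed

section \<open>The maximal function\<close>

lemma cbox_in_sets_lebesgue [measurable]: "cbox a b \<in> sets lebesgue"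
  by simp

text \<open>Multiplying out the volume keeps division in \<open>ennreal\<close> out of the estimates
  below.\<close>

lemma hl_max_le_iff:
  fixes f :: "'a::euclidean_space \<Rightarrow> real"
  shows "hl_max f x \<le> t \<longleftrightarrow> (\<forall>a l. l > 0 \<longrightarrow> x \<in> cube a l \<longrightarrow>
    (\<integral>\<^sup>+y\<in>cube a l. ennreal \<bar>f y\<bar> \<partial>lebesgue) \<le> t * ennreal (l ^ DIM('a)))"
proof -
  have "(\<forall>Q\<in>{Q\<in>cubes. x \<in> Q}. P Q) \<longleftrightarrow> (\<forall>a l. l > 0 \<longrightarrow> x \<in> cube a l \<longrightarrow> P (cube a l))"
    for P :: "'a set \<Rightarrow> bool"
    by (auto simp: cubes_def)
  thus ?thesis
    unfolding hl_max_def SUP_le_iff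
    by (simp add: emeasure_cube divide_le_ennreal_iff del: emeasure_completion)
qed

lemma less_hl_max_iff:
  fixes f :: "'a::euclidean_space \<Rightarrow> real"
  shows "t < hl_max f x \<longleftrightarrow> (\<exists>a l. l > 0 \<and> x \<in> cube a l \<and>
    t * ennreal (l ^ DIM('a)) < (\<integral>\<^sup>+y\<in>cube a l. ennreal \<bar>f y\<bar> \<partial>lebesgue))"
  using hl_max_le_iff[of f x t] by (auto simp: not_le[symmetric])

lemma cube_average_le_hl_max:
  fixes f :: "'a::euclidean_space \<Rightarrow> real"
  assumes "l > 0" "x \<in> cube a l"
  shows "(\<integral>\<^sup>+y\<in>cube a l. ennreal \<bar>f y\<bar> \<partial>lebesgue) \<le> hl_max f x * ennreal (l ^ DIM('a))"
  using hl_max_le_iff[of f x "hl_max f x"] assms by blast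

text \<open>If the average over a cube exceeds \<open>t\<close>, so does the average over a slightly
  larger cube, and that larger cube contains a whole neighbourhood of \<open>x\<close>.
  Measurability of the maximal function follows from openness.\<close>

lemma open_less_hl_max:
  fixes f :: "'a::euclidean_space \<Rightarrow> real"
  shows "open {x. t < hl_max f x}"
proof (subst open_subopen, intro ballI)
  fix x assume "x \<in> {x. t < hl_max f x}"
  hence tx: "t < hl_max f x" by simp
  then obtain r where r: "t = ennreal r" "r \<ge> 0" by (cases t) auto
  obtain a l where al: "l > 0" "x \<in> cube a l"
    and less: "t * ennreal (l ^ DIM('a)) < (\<integral>\<^sup>+y\<in>cube a l. ennreal \<bar>f y\<bar> \<partial>lebesgue)"
    using tx unfolding less_hl_max_iff by blast
  \<comment> \<open>The volume is continuous in the side, so the strict inequality survives moving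
    every face outwards by a small \<open>e\<close>.\<close>
  have "((\<lambda>e. ennreal (r * (l + 2 * e) ^ DIM('a))) \<longlongrightarrow> ennreal (r * (l + 2 * 0) ^ DIM('a))) (at_right 0)"
    by (intro tendsto_intros)
  hence "\<forall>\<^sub>F e in at_right 0. ennreal (r * (l + 2 * e) ^ DIM('a))
           < (\<integral>\<^sup>+y\<in>cube a l. ennreal \<bar>f y\<bar> \<partial>lebesgue)"
    by (rule order_tendstoD) (use less r al in \<open>simp add: ennreal_mult'\<close>)
  moreover have "\<forall>\<^sub>F e in at_right (0::real). e > 0" by (rule eventually_at_right_less)
  ultimately have "\<forall>\<^sub>F e in at_right 0. e > 0 \<and> ennreal (r * (l + 2 * e) ^ DIM('a))
           < (\<integral>\<^sup>+y\<in>cube a l. ennreal \<bar>f y\<bar> \<partial>lebesgue)"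
    by eventually_elim auto
  then obtain e where e: "e > 0" "ennreal (r * (l + 2 * e) ^ DIM('a))
           < (\<integral>\<^sup>+y\<in>cube a l. ennreal \<bar>f y\<bar> \<partial>lebesgue)"
    using eventually_happens'[OF trivial_limit_at_right_real] by blast
  define a' where "a' = a - e *\<^sub>R One"
  have sub: "cube a l \<subseteq> box a' (a' + (l + 2 * e) *\<^sub>R One)"
    using e al by (auto simp: mem_box a'_def inner_add_left inner_diff_left) (smt (verit))+
  have "box a' (a' + (l + 2 * e) *\<^sub>R One) \<subseteq> {x. t < hl_max f x}"
  proof clarify
    fix y assume y: "y \<in> box a' (a' + (l + 2 * e) *\<^sub>R One)"
    have "t * ennreal ((l + 2 * e) ^ DIM('a)) < (\<integral>\<^sup>+y\<in>cube a l. ennreal \<bar>f y\<bar> \<partial>lebesgue)"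
      using e r by (simp add: ennreal_mult')
    also have "\<dots> \<le> (\<integral>\<^sup>+y\<in>cube a' (l + 2 * e). ennreal \<bar>f y\<bar> \<partial>lebesgue)"
      using sub box_subset_cbox[of a' "a' + (l + 2 * e) *\<^sub>R One"]
      by (intro nn_integral_mono) (auto simp: indicator_def)
    finally show "t < hl_max f y"
      unfolding less_hl_max_iff using y box_subset_cbox[of a' "a' + (l + 2 * e) *\<^sub>R One"] al e
      by (intro exI[of _ a'] exI[of _ "l + 2 * e"]) auto
  qed
  moreover have "x \<in> box a' (a' + (l + 2 * e) *\<^sub>R One)" using sub al by blast
  ultimately show "\<exists>T. open T \<and> x \<in> T \<and> T \<subseteq> {x. t < hl_max f x}"
    using open_box by blast
qed

lemma borel_measurable_hl_max: "hl_max f \<in> borel_measurable borel"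
  by (rule borel_measurableI_greater) (simp add: open_less_hl_max)

lemma borel_measurable_hl_max_lebesgue [measurable]: "hl_max f \<in> borel_measurable lebesgue"
  by (rule measurable_completion) (simp add: borel_measurable_hl_max)

section \<open>The weak type inequality for the maximal function\<close>

lemma emeasure_UN_le_count_space:
  assumes [measurable]: "\<And>i. i \<in> I \<Longrightarrow> X i \<in> sets M" and I: "countable I"
  shows "emeasure M (\<Union>i\<in>I. X i) \<le> (\<integral>\<^sup>+i. emeasure M (X i) \<partial>count_space I)"
proof -
  have "emeasure M (\<Union>i\<in>I. X i) = (\<integral>\<^sup>+x. indicator (\<Union>i\<in>I. X i) x \<partial>M)"
    using I by (intro nn_integral_indicator[symmetric] sets.countable_UN') auto
  \<comment> \<open>The indicator of a union is at most the sum of the indicators. Written as an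
    integral over the index set, the sum has the form in which countable additivity is applied to
    the disjoint cubes below.\<close>
  also have "\<dots> \<le> (\<integral>\<^sup>+x. (\<integral>\<^sup>+i. indicator (X i) x \<partial>count_space I) \<partial>M)"
  proof (rule nn_integral_mono)
    fix x
    show "indicator (\<Union>i\<in>I. X i) x \<le> (\<integral>\<^sup>+i. indicator (X i) x \<partial>count_space I)"
    proof (cases "x \<in> (\<Union>i\<in>I. X i)")
      case True
      then obtain j where j: "j \<in> I" "x \<in> X j" by blast
      thus ?thesis
        using nn_integral_ge_point[of j I "\<lambda>i. indicator (X i) x"] True by simp
    qed simp
  qed
  also have "\<dots> = (\<integral>\<^sup>+i. (\<integral>\<^sup>+x. indicator (X i) x \<partial>M) \<partial>count_space I)"
    by (rule nn_integral_count_space_nn_integral) (use I in auto)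
  also have "\<dots> = (\<integral>\<^sup>+i. emeasure M (X i) \<partial>count_space I)"
    by (intro nn_integral_cong) auto
  finally show ?thesis .
qed

text \<open>Vitali covering: the cubes whose average exceeds \<open>t\<close> are placed in balls, a
  disjoint subfamily of the balls is selected, and their fivefold enlargements still cover the
  superlevel set. The selected cubes are disjoint as well, so the integrals of |f| over them add up
  to at most the full integral.\<close>

lemma hl_max_weak_type:
  fixes f :: "'a::euclidean_space \<Rightarrow> real"
  assumes [measurable]: "f \<in> borel_measurable lebesgue" and t: "t > 0"
  shows "ennreal t * emeasure lebesgue {x. ennreal t < hl_max f x}
    \<le> ennreal ((10 * DIM('a)) ^ DIM('a)) * (\<integral>\<^sup>+y. ennreal \<bar>f y\<bar> \<partial>lebesgue)"
proof (cases "(\<integral>\<^sup>+y. ennreal \<bar>f y\<bar> \<partial>lebesgue) = top")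
  case False
  then obtain R where R: "(\<integral>\<^sup>+y. ennreal \<bar>f y\<bar> \<partial>lebesgue) = ennreal R" "R \<ge> 0"
    by (cases "\<integral>\<^sup>+y. ennreal \<bar>f y\<bar> \<partial>lebesgue") auto
  define n where "n = real DIM('a)"
  have n: "n \<ge> 1" unfolding n_def by (simp add: Suc_leI)
  define K where "K = {(a, l). l > 0 \<and> ennreal (t * l ^ DIM('a)) < (\<integral>\<^sup>+y\<in>cube (a::'a) l. ennreal \<bar>f y\<bar> \<partial>lebesgue)}"
  \<comment> \<open>A cube of side \<open>l\<close> lies in the ball of radius \<open>n * l\<close>
    about its centre.\<close>
  define c where "c = (\<lambda>(a::'a, l::real). a + (l / 2) *\<^sub>R One)"
  define r where "r = (\<lambda>(a::'a, l). n * l)"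
  have cube_cball: "cube a l \<subseteq> cball (c (a, l)) (r (a, l))" if "l > 0" for a l
  proof
    fix x assume "x \<in> cube a l"
    moreover have "c (a, l) \<in> cube a l" using that by (auto simp: c_def mem_cube inner_add_left)
    ultimately show "x \<in> cball (c (a, l)) (r (a, l))"
      using norm_diff_le_cube[of "c (a, l)" a l x] by (auto simp: dist_norm r_def n_def)
  qed
  have cover: "{x. ennreal t < hl_max f x} \<subseteq> (\<Union>i\<in>K. cball (c i) (r i))"
  proof clarify
    fix x assume "ennreal t < hl_max f x"
    then obtain a l where "l > 0" "x \<in> cube a l"
      "ennreal t * ennreal (l ^ DIM('a)) < (\<integral>\<^sup>+y\<in>cube a l. ennreal \<bar>f y\<bar> \<partial>lebesgue)"
      unfolding less_hl_max_iff by blast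
    with cube_cball[of l a] t show "x \<in> (\<Union>i\<in>K. cball (c i) (r i))"
      by (intro UN_I[of "(a, l)"]) (auto simp: K_def ennreal_mult')
  qed
  \<comment> \<open>The covering lemma requires bounded radii. Here
    \<open>t * l ^ DIM('a) < R\<close>, and the \<open>max 1\<close> saves taking a root.\<close>
  have bound: "0 < r i \<and> r i \<le> n * max 1 (R / t)" if "i \<in> K" for i
  proof -
    obtain a l where i: "i = (a, l)" by (cases i)
    have l: "l > 0" and "ennreal (t * l ^ DIM('a)) < (\<integral>\<^sup>+y\<in>cube a l. ennreal \<bar>f y\<bar> \<partial>lebesgue)"
      using that by (auto simp: K_def i)
    note this(2)
    also have "(\<integral>\<^sup>+y\<in>cube a l. ennreal \<bar>f y\<bar> \<partial>lebesgue) \<le> (\<integral>\<^sup>+y. ennreal \<bar>f y\<bar> \<partial>lebesgue)"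
      by (intro nn_integral_mono) (auto simp: indicator_def)
    finally have *: "t * l ^ DIM('a) < R" using R t l by (simp add: ennreal_less_iff)
    have "l \<le> max 1 (R / t)"
    proof (cases "l \<le> 1")
      case False
      have "l ^ 1 \<le> l ^ DIM('a)" using False by (intro power_increasing) (auto simp: Suc_leI)
      hence "t * l \<le> t * l ^ DIM('a)" using t by simp
      with * have "t * l \<le> R" by linarith
      hence "l \<le> R / t" using t by (simp add: field_simps)
      thus ?thesis by simp
    qed simp
    thus ?thesis using l n by (auto simp: r_def i)
  qed
  obtain C where C: "countable C" "C \<subseteq> K"
     "pairwise (\<lambda>i j. disjnt (cball (c i) (r i)) (cball (c j) (r j))) C"
     "{x. ennreal t < hl_max f x} \<subseteq> (\<Union>i\<in>C. cball (c i) (5 * r i))"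
    by (rule Vitali_covering_lemma_cballs[OF cover bound])
  define Q where "Q = (\<lambda>(a::'a, l). cube a l)"
  have Q_cball: "Q i \<subseteq> cball (c i) (r i)" if "i \<in> C" for i
    using that C(2) cube_cball by (auto simp: Q_def K_def)
  have Q_sets: "Q i \<in> sets lebesgue" for i by (auto simp: Q_def split: prod.split)
  have disj: "disjoint_family_on Q C"
    unfolding disjoint_family_on_def
  proof (intro ballI impI)
    fix i j assume "i \<in> C" "j \<in> C" "i \<noteq> j"
    with C(3) have "cball (c i) (r i) \<inter> cball (c j) (r j) = {}"
      by (auto simp: pairwise_def disjnt_def)
    with Q_cball[OF \<open>i \<in> C\<close>] Q_cball[OF \<open>j \<in> C\<close>] show "Q i \<inter> Q j = {}" by blast
  qed
  have ball: "ennreal t * emeasure lebesgue (cball (c i) (5 * r i))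
      \<le> ennreal ((10 * n) ^ DIM('a)) * emeasure (density lebesgue (\<lambda>y. ennreal \<bar>f y\<bar>)) (Q i)" if "i \<in> C" for i
  proof -
    obtain a l where i: "i = (a, l)" by (cases i)
    have l: "l > 0" and less: "ennreal (t * l ^ DIM('a)) < (\<integral>\<^sup>+y\<in>cube a l. ennreal \<bar>f y\<bar> \<partial>lebesgue)"
      using that C(2) by (auto simp: K_def i)
    \<comment> \<open>Source of the constant: the fivefold ball fits into a cube of side
      \<open>10 * n * l\<close>, whose volume is explicit.\<close>
    have "cball (c i) (5 * r i) \<subseteq> cube (c i - (5 * r i) *\<^sub>R One) (10 * r i)"
    proof
      fix x assume x: "x \<in> cball (c i) (5 * r i)"
      show "x \<in> cube (c i - (5 * r i) *\<^sub>R One) (10 * r i)"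
        unfolding mem_cube
      proof
        fix j :: 'a assume j: "j \<in> Basis"
        have "\<bar>x \<bullet> j - c i \<bullet> j\<bar> \<le> 5 * r i"
          using Basis_le_norm[OF j, of "x - c i"] x
          by (auto simp: dist_norm norm_minus_commute inner_diff_left)
        thus "(c i - (5 * r i) *\<^sub>R One) \<bullet> j \<le> x \<bullet> j \<and>
            x \<bullet> j \<le> (c i - (5 * r i) *\<^sub>R One) \<bullet> j + 10 * r i"
          using j by (simp add: abs_le_iff inner_diff_left)
      qed
    qed
    hence "emeasure lebesgue (cball (c i) (5 * r i)) \<le> emeasure lebesgue (cube (c i - (5 * r i) *\<^sub>R One) (10 * r i))"
      by (intro emeasure_mono) auto
    also have "\<dots> = ennreal ((10 * n * l) ^ DIM('a))"
      using n l by (subst emeasure_cube) (auto simp: r_def i mult.assoc)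
    finally have "ennreal t * emeasure lebesgue (cball (c i) (5 * r i)) \<le> ennreal t * ennreal ((10 * n * l) ^ DIM('a))"
      by (intro mult_left_mono) auto
    also have "\<dots> = ennreal ((10 * n) ^ DIM('a)) * ennreal (t * l ^ DIM('a))"
      using t l n by (simp add: power_mult_distrib mult_ac flip: ennreal_mult)
    also have "\<dots> \<le> ennreal ((10 * n) ^ DIM('a)) * (\<integral>\<^sup>+y\<in>cube a l. ennreal \<bar>f y\<bar> \<partial>lebesgue)"
      using less by (intro mult_left_mono) auto
    also have "(\<integral>\<^sup>+y\<in>cube a l. ennreal \<bar>f y\<bar> \<partial>lebesgue) = emeasure (density lebesgue (\<lambda>y. ennreal \<bar>f y\<bar>)) (Q i)"
      by (subst emeasure_density) (auto simp: Q_def i)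
    finally show ?thesis .
  qed
  have "emeasure lebesgue {x. ennreal t < hl_max f x} \<le> emeasure lebesgue (\<Union>i\<in>C. cball (c i) (5 * r i))"
    using C by (intro emeasure_mono sets.countable_UN') auto
  also have "\<dots> \<le> (\<integral>\<^sup>+i. emeasure lebesgue (cball (c i) (5 * r i)) \<partial>count_space C)"
    using C by (intro emeasure_UN_le_count_space) auto
  finally have "ennreal t * emeasure lebesgue {x. ennreal t < hl_max f x}
    \<le> ennreal t * (\<integral>\<^sup>+i. emeasure lebesgue (cball (c i) (5 * r i)) \<partial>count_space C)"
    by (intro mult_left_mono) auto
  also have "\<dots> = (\<integral>\<^sup>+i. ennreal t * emeasure lebesgue (cball (c i) (5 * r i)) \<partial>count_space C)"
    by (simp add: nn_integral_cmult)
  also have "\<dots> \<le> (\<integral>\<^sup>+i. ennreal ((10 * n) ^ DIM('a)) * emeasure (density lebesgue (\<lambda>y. ennreal \<bar>f y\<bar>)) (Q i) \<partial>count_space C)"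
    by (intro nn_integral_mono) (use ball in auto)
  \<comment> \<open>With |f| as a density, the sum over the disjoint cubes is the measure of their
    union.\<close>
  also have "\<dots> = ennreal ((10 * n) ^ DIM('a)) * emeasure (density lebesgue (\<lambda>y. ennreal \<bar>f y\<bar>)) (\<Union>i\<in>C. Q i)"
    using Q_sets C(1) disj by (subst emeasure_UN_countable) (auto simp: nn_integral_cmult)
  also have "\<dots> \<le> ennreal ((10 * n) ^ DIM('a)) * emeasure (density lebesgue (\<lambda>y. ennreal \<bar>f y\<bar>)) UNIV"
    by (intro mult_left_mono emeasure_mono) auto
  also have "emeasure (density lebesgue (\<lambda>y. ennreal \<bar>f y\<bar>)) UNIV = (\<integral>\<^sup>+y. ennreal \<bar>f y\<bar> \<partial>lebesgue)"
    by (subst emeasure_density) auto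
  finally show ?thesis by (simp add: n_def)
qed (simp add: ennreal_mult_top)


section \<open>The strong type inequality for the maximal function\<close>

lemma sigma_finite_lebesgue: "sigma_finite_measure (lebesgue :: 'a::euclidean_space measure)"
proof
  show "\<exists>A::'a set set. countable A \<and> A \<subseteq> sets lebesgue \<and> \<Union>A = space lebesgue \<and>
      (\<forall>a\<in>A. emeasure lebesgue a \<noteq> \<infinity>)"
    by (intro exI[of _ "range (\<lambda>n::nat. box (- real n *\<^sub>R One) (real n *\<^sub>R One))"])
       (auto simp: emeasure_lborel_box_eq UN_box_eq_UNIV)
qed

lemma nn_integral_powr_Icc:
  assumes "a > -1" "c \<ge> (0::real)"
  shows "(\<integral>\<^sup>+t. ennreal (t powr a) * indicator {0..c} t \<partial>lborel) = ennreal (c powr (a + 1) / (a + 1))"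
  by (rule nn_integral_has_integral_lebesgue') (use has_integral_powr_from_0[OF assms] in auto)

text \<open>The integral of \<open>p * t powr (p - 1)\<close> over \<open>{0..c}\<close> is
  \<open>c powr p\<close>; this is used for every finite \<open>c\<close> below \<open>u\<close>, so
  that \<open>u = top\<close> is covered by letting \<open>c\<close> grow.\<close>

lemma enn_powr_layer_cake:
  assumes "p > 0"
  shows "enn_powr u p \<le> (\<integral>\<^sup>+t. ennreal (p * t powr (p - 1)) *
    indicator {t. 0 \<le> t \<and> ennreal t \<le> u} t \<partial>lborel)"
proof -
  have *: "ennreal (c powr p) \<le> (\<integral>\<^sup>+t. ennreal (p * t powr (p - 1)) *
      indicator {t. 0 \<le> t \<and> ennreal t \<le> u} t \<partial>lborel)" if "0 \<le> c" "ennreal c \<le> u" for c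
  proof -
    have below: "ennreal t \<le> u" if "t \<le> c" for t
      using ennreal_leI[OF that] \<open>ennreal c \<le> u\<close> by (rule order_trans)
    have "ennreal (c powr p) = ennreal p * ennreal (c powr (p - 1 + 1) / (p - 1 + 1))"
      using assms by (simp flip: ennreal_mult)
    also have "\<dots> = ennreal p * (\<integral>\<^sup>+t. ennreal (t powr (p - 1)) * indicator {0..c} t \<partial>lborel)"
      using assms that by (subst nn_integral_powr_Icc) auto
    also have "\<dots> = (\<integral>\<^sup>+t. ennreal (p * t powr (p - 1)) * indicator {0..c} t \<partial>lborel)"
      using assms by (subst nn_integral_cmult[symmetric]) (auto simp: ennreal_mult mult.assoc)
    also have "\<dots> \<le> (\<integral>\<^sup>+t. ennreal (p * t powr (p - 1)) *
      indicator {t. 0 \<le> t \<and> ennreal t \<le> u} t \<partial>lborel)"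
      by (intro nn_integral_mono) (use below in \<open>auto simp: indicator_def\<close>)
    finally show ?thesis .
  qed
  show ?thesis
  proof (cases u)
    case (real r)
    thus ?thesis using *[of r] by (simp add: enn_powr_ennreal)
  next
    case top
    have "(\<integral>\<^sup>+t. ennreal (p * t powr (p - 1)) *
      indicator {t. 0 \<le> t \<and> ennreal t \<le> u} t \<partial>lborel) = top" (is "?I = top")
    proof (cases ?I)
      case (real r)
      \<comment> \<open>A finite value \<open>r\<close> is refuted by the choice
        \<open>c = (r + 1) powr (1 / p)\<close>.\<close>
      have "ennreal (r + 1) \<le> ?I"
        using *[of "(r + 1) powr (1 / p)"] real(1) assms by (simp add: top powr_powr)
      thus ?thesis unfolding real(2) using real(1) by simp
    qed
    thus ?thesis by simp
  qed
qed

text \<open>Dropping the values of |f| below \<open>t / 4\<close> lowers the maximal function by at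
  most \<open>t / 4\<close>. From \<open>t\<close> this leaves \<open>3 * t / 4\<close>, strictly
  above the level \<open>t / 2\<close> at which the weak type inequality is applied; a cut at
  \<open>t / 2\<close> would only leave a non-strict inequality.\<close>

lemma hl_max_weak_type_truncated:
  fixes f :: "'a::euclidean_space \<Rightarrow> real"
  assumes [measurable]: "f \<in> borel_measurable lebesgue" and t: "t > 0"
  shows "emeasure lebesgue {x. ennreal t \<le> hl_max f x}
    \<le> ennreal (2 * (10 * DIM('a)) ^ DIM('a) / t) *
       (\<integral>\<^sup>+y. ennreal \<bar>f y\<bar> * indicator {y. t \<le> 4 * \<bar>f y\<bar>} y \<partial>lebesgue)"
proof -
  define f' where "f' = (\<lambda>y. if t \<le> 4 * \<bar>f y\<bar> then f y else 0)"
  have f' [measurable]: "f' \<in> borel_measurable lebesgue" unfolding f'_def by measurable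
  have le: "hl_max f x \<le> hl_max f' x + ennreal (t / 4)" for x
    unfolding hl_max_le_iff
  proof safe
    fix a :: 'a and l :: real assume al: "l > 0" "x \<in> cube a l"
    have "(\<integral>\<^sup>+y\<in>cube a l. ennreal \<bar>f y\<bar> \<partial>lebesgue)
        \<le> (\<integral>\<^sup>+y. ennreal \<bar>f' y\<bar> * indicator (cube a l) y + ennreal (t / 4) * indicator (cube a l) y \<partial>lebesgue)"
      by (intro nn_integral_mono) (auto simp: f'_def indicator_def intro!: ennreal_leI)
    also have "\<dots> = (\<integral>\<^sup>+y\<in>cube a l. ennreal \<bar>f' y\<bar> \<partial>lebesgue) + ennreal (t / 4) * ennreal (l ^ DIM('a))"
      using al by (subst nn_integral_add)
        (auto simp: nn_integral_cmult_indicator emeasure_cube simp del: emeasure_completion)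
    also have "\<dots> \<le> hl_max f' x * ennreal (l ^ DIM('a)) + ennreal (t / 4) * ennreal (l ^ DIM('a))"
      using al by (intro add_right_mono cube_average_le_hl_max)
    finally show "(\<integral>\<^sup>+y\<in>cube a l. ennreal \<bar>f y\<bar> \<partial>lebesgue) \<le> (hl_max f' x + ennreal (t / 4)) * ennreal (l ^ DIM('a))"
      by (simp add: distrib_right)
  qed
  have "ennreal (t / 2) < hl_max f' x" if "ennreal t \<le> hl_max f x" for x
  proof (rule ccontr)
    assume "\<not> ennreal (t / 2) < hl_max f' x"
    hence "hl_max f' x + ennreal (t / 4) \<le> ennreal (t / 2) + ennreal (t / 4)"
      by (intro add_right_mono) auto
    with that le[of x] have "ennreal t \<le> ennreal (t / 2) + ennreal (t / 4)" by (meson order_trans)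
    hence "ennreal t \<le> ennreal (t / 2 + t / 4)" using t by (subst ennreal_plus) auto
    thus False using t by simp
  qed
  hence "emeasure lebesgue {x. ennreal t \<le> hl_max f x} \<le> emeasure lebesgue {x. ennreal (t / 2) < hl_max f' x}"
    using open_less_hl_max[of "ennreal (t/2)" f'] by (intro emeasure_mono) auto
  also have "\<dots> = ennreal (2 / t) * (ennreal (t / 2) * emeasure lebesgue {x. ennreal (t / 2) < hl_max f' x})"
    using t by (simp add: mult.assoc[symmetric] flip: ennreal_mult)
  also have "\<dots> \<le> ennreal (2 / t) * (ennreal ((10 * DIM('a)) ^ DIM('a)) * (\<integral>\<^sup>+y. ennreal \<bar>f' y\<bar> \<partial>lebesgue))"
    using t by (intro mult_left_mono hl_max_weak_type) auto
  also have "(\<integral>\<^sup>+y. ennreal \<bar>f' y\<bar> \<partial>lebesgue) =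
     (\<integral>\<^sup>+y. ennreal \<bar>f y\<bar> * indicator {y. t \<le> 4 * \<bar>f y\<bar>} y \<partial>lebesgue)"
    by (intro nn_integral_cong) (auto simp: f'_def)
  also have "ennreal (2 / t) * (ennreal ((10 * DIM('a)) ^ DIM('a)) * \<dots>) =
    ennreal (2 * (10 * DIM('a)) ^ DIM('a) / t) * \<dots>"
    using t by (simp add: mult.assoc[symmetric] flip: ennreal_mult)
  finally show ?thesis .
qed

text \<open>Marcinkiewicz interpolation done by hand: layer cake, the truncated weak type bound at
  each level \<open>t\<close>, and Fubini. The remaining integral of \<open>t powr (p - 2)\<close>
  over \<open>{0..4 * |f y|}\<close> converges at 0 because \<open>p > 1\<close>, and yields |f| to
  the power \<open>p\<close>.\<close>

lemma hl_max_strong_type: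
  assumes p: "p > 1"
  obtains A where "A \<ge> 0" "\<And>f::'a::euclidean_space \<Rightarrow> real. f \<in> borel_measurable lebesgue \<Longrightarrow>
    (\<integral>\<^sup>+x. enn_powr (hl_max f x) p \<partial>lebesgue) \<le> ennreal A * (\<integral>\<^sup>+x. ennreal (\<bar>f x\<bar> powr p) \<partial>lebesgue)"
proof
  define B where "B = 2 * (10 * real DIM('a)) ^ DIM('a)"
  have B: "B \<ge> 0" by (simp add: B_def)
  show "p * B * (4 powr (p - 1) / (p - 1)) \<ge> 0" using p B by simp
  fix f :: "'a \<Rightarrow> real"
  assume f [measurable]: "f \<in> borel_measurable lebesgue"
  interpret leb: sigma_finite_measure "lebesgue :: 'a measure" by (rule sigma_finite_lebesgue)
  interpret pair: pair_sigma_finite "lborel :: real measure" "lebesgue :: 'a measure" ..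
  have "(\<integral>\<^sup>+x. enn_powr (hl_max f x) p \<partial>lebesgue) \<le>
     (\<integral>\<^sup>+x. (\<integral>\<^sup>+t. ennreal (p * t powr (p - 1)) *
        indicator {t. 0 \<le> t \<and> ennreal t \<le> hl_max f x} t \<partial>lborel) \<partial>lebesgue)"
    using p by (intro nn_integral_mono enn_powr_layer_cake) auto
  also have "\<dots> = (\<integral>\<^sup>+t. (\<integral>\<^sup>+x. ennreal (p * t powr (p - 1)) *
        indicator {t. 0 \<le> t \<and> ennreal t \<le> hl_max f x} t \<partial>lebesgue) \<partial>lborel)"
    by (rule pair.Fubini') measurable
  also have "\<dots> \<le> (\<integral>\<^sup>+t. (\<integral>\<^sup>+y. ennreal (p * B) * ennreal \<bar>f y\<bar> *
        (ennreal (t powr (p - 2)) * indicator {0..4 * \<bar>f y\<bar>} t) \<partial>lebesgue) \<partial>lborel)"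
  proof (rule nn_integral_mono)
    fix t :: real
    show "(\<integral>\<^sup>+x. ennreal (p * t powr (p - 1)) * indicator {t. 0 \<le> t \<and> ennreal t \<le> hl_max f x} t \<partial>lebesgue)
      \<le> (\<integral>\<^sup>+y. ennreal (p * B) * ennreal \<bar>f y\<bar> *
        (ennreal (t powr (p - 2)) * indicator {0..4 * \<bar>f y\<bar>} t) \<partial>lebesgue)"
    proof (cases "t > 0")
      case True
      have "(\<integral>\<^sup>+x. ennreal (p * t powr (p - 1)) * indicator {t. 0 \<le> t \<and> ennreal t \<le> hl_max f x} t \<partial>lebesgue)
          = (\<integral>\<^sup>+x. ennreal (p * t powr (p - 1)) * indicator {x. ennreal t \<le> hl_max f x} x \<partial>lebesgue)"
        using True by (intro nn_integral_cong) (auto simp: indicator_def)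
      also have "\<dots> = ennreal (p * t powr (p - 1)) * emeasure lebesgue {x. ennreal t \<le> hl_max f x}"
      proof (intro nn_integral_cmult_indicator)
        have "{x \<in> space lebesgue. ennreal t \<le> hl_max f x} \<in> sets lebesgue" by measurable
        thus "{x. ennreal t \<le> hl_max f x} \<in> sets lebesgue" by simp
      qed
      also have "\<dots> \<le> ennreal (p * t powr (p - 1)) * (ennreal (B / t) *
          (\<integral>\<^sup>+y. ennreal \<bar>f y\<bar> * indicator {y. t \<le> 4 * \<bar>f y\<bar>} y \<partial>lebesgue))"
        using hl_max_weak_type_truncated[OF f True] unfolding B_def
        by (intro mult_left_mono) simp_all
      also have "ennreal (p * t powr (p - 1)) * (ennreal (B / t) *
          (\<integral>\<^sup>+y. ennreal \<bar>f y\<bar> * indicator {y. t \<le> 4 * \<bar>f y\<bar>} y \<partial>lebesgue)) =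
          ennreal (p * B * t powr (p - 2)) * (\<integral>\<^sup>+y. ennreal \<bar>f y\<bar> * indicator {y. t \<le> 4 * \<bar>f y\<bar>} y \<partial>lebesgue)"
      proof -
        have "t powr (p - 1) = t powr (p - 2) * t" using True powr_mult_base[of t "p - 2"] by (simp add: mult.commute)
        hence "p * t powr (p - 1) * (B / t) = p * B * t powr (p - 2)" using True by simp
        thus ?thesis using p B True by (simp add: mult.assoc[symmetric] flip: ennreal_mult)
      qed
      also have "\<dots> = (\<integral>\<^sup>+y. ennreal (p * B * t powr (p - 2)) * (ennreal \<bar>f y\<bar> * indicator {y. t \<le> 4 * \<bar>f y\<bar>} y) \<partial>lebesgue)"
        by (subst nn_integral_cmult) auto
      also have "\<dots> = (\<integral>\<^sup>+y. ennreal (p * B) * ennreal \<bar>f y\<bar> *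
        (ennreal (t powr (p - 2)) * indicator {0..4 * \<bar>f y\<bar>} t) \<partial>lebesgue)"
        using p B True by (intro nn_integral_cong) (auto simp: indicator_def ennreal_mult mult_ac)
      finally show ?thesis .
    next
      case False
      \<comment> \<open>For \<open>t = 0\<close> the power is 0, and for negative \<open>t\<close>
        the indicator is.\<close>
      hence "ennreal (p * t powr (p - 1)) * indicator {t. 0 \<le> t \<and> ennreal t \<le> u} t = 0" for u
        by (cases "t = 0") (auto simp: indicator_def)
      thus ?thesis by (simp only: nn_integral_const) simp
    qed
  qed
  also have "\<dots> = (\<integral>\<^sup>+y. (\<integral>\<^sup>+t. ennreal (p * B) * ennreal \<bar>f y\<bar> *
        (ennreal (t powr (p - 2)) * indicator {0..4 * \<bar>f y\<bar>} t) \<partial>lborel) \<partial>lebesgue)"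
    \<comment> \<open>The interval of integration depends on \<open>y\<close>, so the indicator is
      opened to obtain joint measurability.\<close>
    by (rule pair.Fubini'[symmetric], unfold indicator_def atLeastAtMost_iff, measurable)
  also have "\<dots> = (\<integral>\<^sup>+y. ennreal (p * B) * ennreal \<bar>f y\<bar> * ennreal ((4 * \<bar>f y\<bar>) powr (p - 1) / (p - 1)) \<partial>lebesgue)"
  proof (rule nn_integral_cong)
    fix y
    show "(\<integral>\<^sup>+t. ennreal (p * B) * ennreal \<bar>f y\<bar> *
        (ennreal (t powr (p - 2)) * indicator {0..4 * \<bar>f y\<bar>} t) \<partial>lborel)
      = ennreal (p * B) * ennreal \<bar>f y\<bar> * ennreal ((4 * \<bar>f y\<bar>) powr (p - 1) / (p - 1))"
      using nn_integral_powr_Icc[of "p - 2" "4 * \<bar>f y\<bar>"] p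
      by (subst nn_integral_cmult) auto
  qed
  also have "\<dots> = (\<integral>\<^sup>+y. ennreal (p * B * (4 powr (p - 1) / (p - 1))) * ennreal (\<bar>f y\<bar> powr p) \<partial>lebesgue)"
  proof (rule nn_integral_cong)
    fix y
    have "\<bar>f y\<bar> powr p = \<bar>f y\<bar> * \<bar>f y\<bar> powr (p - 1)" by (simp add: powr_mult_base)
    hence "p * B * \<bar>f y\<bar> * ((4 * \<bar>f y\<bar>) powr (p - 1) / (p - 1)) = p * B * (4 powr (p - 1) / (p - 1)) * \<bar>f y\<bar> powr p"
      by (simp add: powr_mult)
    thus "ennreal (p * B) * ennreal \<bar>f y\<bar> * ennreal ((4 * \<bar>f y\<bar>) powr (p - 1) / (p - 1))
        = ennreal (p * B * (4 powr (p - 1) / (p - 1))) * ennreal (\<bar>f y\<bar> powr p)"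
      using p B by (simp flip: ennreal_mult)
  qed
  also have "\<dots> = ennreal (p * B * (4 powr (p - 1) / (p - 1))) * (\<integral>\<^sup>+y. ennreal (\<bar>f y\<bar> powr p) \<partial>lebesgue)"
    by (subst nn_integral_cmult) auto
  finally show "(\<integral>\<^sup>+x. enn_powr (hl_max f x) p \<partial>lebesgue)
     \<le> ennreal (p * B * (4 powr (p - 1) / (p - 1))) * (\<integral>\<^sup>+x. ennreal (\<bar>f x\<bar> powr p) \<partial>lebesgue)" .
qed

section \<open>The maximal function on Morrey spaces\<close>

lemma morrey_cube_average:
  fixes f :: "'a::euclidean_space \<Rightarrow> real"
  assumes [measurable]: "f \<in> borel_measurable lebesgue" and "p > 1" "F \<ge> 0" "l > 0"
    and le: "(\<integral>\<^sup>+x\<in>cube a l. ennreal (\<bar>f x\<bar> powr p) \<partial>lebesgue) \<le> ennreal (F powr p * l powr lam)"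
  shows "(\<integral>\<^sup>+x\<in>cube a l. ennreal \<bar>f x\<bar> \<partial>lebesgue)
    \<le> ennreal (2 * F * l powr ((lam - DIM('a)) / p)) * ennreal (l ^ DIM('a))"
proof -
  \<comment> \<open>The value \<open>s = F * l powr ((lam - n) / p)\<close>, with \<open>n\<close>
    the dimension, is chosen so that \<open>s powr p\<close> times the volume is the Morrey bound;
    the factor 2 is that of the Hoelder substitute.\<close>
  have "(F * l powr ((lam - DIM('a)) / p)) powr p * l ^ DIM('a) = F powr p * (l powr (lam - DIM('a)) * l powr DIM('a))"
    using assms by (simp add: powr_mult powr_powr powr_realpow)
  also have "\<dots> = F powr p * l powr lam" by (simp flip: powr_add)
  finally have "(\<integral>\<^sup>+x\<in>cube a l. ennreal \<bar>f x\<bar> \<partial>lebesgue)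
      \<le> ennreal (2 * (F * l powr ((lam - DIM('a)) / p)) * l ^ DIM('a))"
    using assms by (intro set_nn_integral_le_of_powr[where p = p])
       (auto simp: emeasure_cube enn_powr_ennreal simp del: emeasure_completion)
  thus ?thesis using assms by (simp add: mult.assoc flip: ennreal_mult)
qed

text \<open>Cubes through a point of \<open>cube a l\<close> with side at most \<open>l\<close> lie
  in the concentric cube of triple side, so they only see \<open>f1\<close>, to which the strong
  type inequality applies. Larger cubes have averages at most \<open>s\<close>, by the decay of
  averages in the Morrey space.\<close>

lemma hl_max_morrey:
  fixes p lam :: real
  assumes p: "p > 1" and lam: "lam < DIM('a::euclidean_space)"
  obtains A where "A \<ge> 0" "\<And>(f::'a \<Rightarrow> real) F a l. f \<in> borel_measurable lebesgue \<Longrightarrow> F \<ge> 0 \<Longrightarrow>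
    (\<And>a l. l > 0 \<Longrightarrow> (\<integral>\<^sup>+x\<in>cube a l. ennreal (\<bar>f x\<bar> powr p) \<partial>lebesgue) \<le> ennreal (F powr p * l powr lam)) \<Longrightarrow>
    l > 0 \<Longrightarrow> (\<integral>\<^sup>+x\<in>cube a l. enn_powr (hl_max f x) p \<partial>lebesgue) \<le> ennreal (A * F powr p * l powr lam)"
proof -
  obtain A where A: "A \<ge> 0" "\<And>f::'a \<Rightarrow> real. f \<in> borel_measurable lebesgue \<Longrightarrow>
    (\<integral>\<^sup>+x. enn_powr (hl_max f x) p \<partial>lebesgue) \<le> ennreal A * (\<integral>\<^sup>+x. ennreal (\<bar>f x\<bar> powr p) \<partial>lebesgue)"
    using hl_max_strong_type[OF p] by blast
  show ?thesis
  \<comment> \<open>\<open>3 powr lam\<close> comes from the Morrey bound on the triple cube,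
    \<open>2 powr p\<close> from the constant \<open>s\<close>.\<close>
  proof (rule that[of "A * 3 powr lam + 2 powr p"])
    show "A * 3 powr lam + 2 powr p \<ge> 0" using A by simp
    fix f :: "'a \<Rightarrow> real" and F l :: real and a :: 'a
    assume f [measurable]: "f \<in> borel_measurable lebesgue" and F: "F \<ge> 0" and l: "l > 0"
      and le: "\<And>a l. l > 0 \<Longrightarrow> (\<integral>\<^sup>+x\<in>cube a l. ennreal (\<bar>f x\<bar> powr p) \<partial>lebesgue) \<le> ennreal (F powr p * l powr lam)"
    define T where "T = cube (a - l *\<^sub>R One) (3 * l)"
    have T [measurable]: "T \<in> sets lebesgue" unfolding T_def by simp
    define f1 where "f1 = (\<lambda>y. f y * indicator T y)"
    have f1 [measurable]: "f1 \<in> borel_measurable lebesgue" unfolding f1_def by measurable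
    define s where "s = 2 * F * l powr ((lam - DIM('a)) / p)"
    have s: "s \<ge> 0" using F by (simp add: s_def)
    have le1: "hl_max f x \<le> max (hl_max f1 x) (ennreal s)" if x: "x \<in> cube a l" for x
      unfolding hl_max_le_iff
    proof safe
      fix a' :: 'a and r :: real assume r: "r > 0" "x \<in> cube a' r"
      show "(\<integral>\<^sup>+y\<in>cube a' r. ennreal \<bar>f y\<bar> \<partial>lebesgue) \<le> max (hl_max f1 x) (ennreal s) * ennreal (r ^ DIM('a))"
      proof (cases "r \<le> l")
        case True
        have "cube a' r \<subseteq> T"
        proof
          fix y assume y: "y \<in> cube a' r"
          show "y \<in> T" unfolding T_def mem_cube
          proof
            fix i :: 'a assume i: "i \<in> Basis"
            hence "a' \<bullet> i \<le> y \<bullet> i" "y \<bullet> i \<le> a' \<bullet> i + r" "a' \<bullet> i \<le> x \<bullet> i" "x \<bullet> i \<le> a' \<bullet> i + r"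
                "a \<bullet> i \<le> x \<bullet> i" "x \<bullet> i \<le> a \<bullet> i + l"
              using x y r by (auto simp: mem_cube)
            thus "(a - l *\<^sub>R One) \<bullet> i \<le> y \<bullet> i \<and> y \<bullet> i \<le> (a - l *\<^sub>R One) \<bullet> i + 3 * l"
              using True i by (simp add: inner_diff_left)
          qed
        qed
        hence "(\<integral>\<^sup>+y\<in>cube a' r. ennreal \<bar>f y\<bar> \<partial>lebesgue) = (\<integral>\<^sup>+y\<in>cube a' r. ennreal \<bar>f1 y\<bar> \<partial>lebesgue)"
          by (intro nn_integral_cong) (auto simp: f1_def indicator_def)
        also have "\<dots> \<le> hl_max f1 x * ennreal (r ^ DIM('a))"
          by (intro cube_average_le_hl_max r)
        also have "\<dots> \<le> max (hl_max f1 x) (ennreal s) * ennreal (r ^ DIM('a))"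
          by (intro mult_right_mono) auto
        finally show ?thesis .
      next
        case False
        have "(\<integral>\<^sup>+y\<in>cube a' r. ennreal \<bar>f y\<bar> \<partial>lebesgue)
            \<le> ennreal (2 * F * r powr ((lam - DIM('a)) / p)) * ennreal (r ^ DIM('a))"
          by (intro morrey_cube_average f p F r le)
        also have "\<dots> \<le> max (hl_max f1 x) (ennreal s) * ennreal (r ^ DIM('a))"
        proof (intro mult_right_mono max.coboundedI2 ennreal_leI)
          \<comment> \<open>This is where \<open>lam < DIM('a)\<close> enters: the bound on averages
            decreases in the side.\<close>
          have "(lam - DIM('a)) / p \<le> 0" using lam p by (simp add: divide_nonpos_pos)
          thus "2 * F * r powr ((lam - DIM('a)) / p) \<le> s"
            unfolding s_def using False l F by (intro mult_left_mono powr_mono2') auto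
        qed simp
        finally show ?thesis .
      qed
    qed
    have "(\<integral>\<^sup>+x\<in>cube a l. enn_powr (hl_max f x) p \<partial>lebesgue)
       \<le> (\<integral>\<^sup>+x. enn_powr (hl_max f1 x) p + ennreal (s powr p) * indicator (cube a l) x \<partial>lebesgue)"
    proof (rule nn_integral_mono)
      fix x :: 'a
      show "enn_powr (hl_max f x) p * indicator (cube a l) x
          \<le> enn_powr (hl_max f1 x) p + ennreal (s powr p) * indicator (cube a l) x"
      proof (cases "x \<in> cube a l")
        case True
        have "enn_powr (hl_max f x) p \<le> enn_powr (max (hl_max f1 x) (ennreal s)) p"
          using p by (intro enn_powr_mono le1 True) auto
        also have "\<dots> \<le> enn_powr (hl_max f1 x) p + enn_powr (ennreal s) p"
          using p by (intro enn_powr_max_le) auto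
        finally show ?thesis using True s by (simp add: enn_powr_ennreal)
      qed simp
    qed
    also have "\<dots> = (\<integral>\<^sup>+x. enn_powr (hl_max f1 x) p \<partial>lebesgue) + ennreal (s powr p) * ennreal (l ^ DIM('a))"
      using l by (subst nn_integral_add)
        (auto simp: nn_integral_cmult_indicator emeasure_cube simp del: emeasure_completion)
    also have "\<dots> \<le> ennreal A * ennreal (F powr p * (3 * l) powr lam) + ennreal (s powr p) * ennreal (l ^ DIM('a))"
    proof (intro add_right_mono)
      have "(\<integral>\<^sup>+x. enn_powr (hl_max f1 x) p \<partial>lebesgue) \<le> ennreal A * (\<integral>\<^sup>+x. ennreal (\<bar>f1 x\<bar> powr p) \<partial>lebesgue)"
        by (intro A f1)
      also have "(\<integral>\<^sup>+x. ennreal (\<bar>f1 x\<bar> powr p) \<partial>lebesgue) = (\<integral>\<^sup>+x\<in>T. ennreal (\<bar>f x\<bar> powr p) \<partial>lebesgue)"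
        by (intro nn_integral_cong) (auto simp: f1_def indicator_def)
      also have "\<dots> \<le> ennreal (F powr p * (3 * l) powr lam)"
        unfolding T_def by (intro le) (use l in auto)
      finally show "(\<integral>\<^sup>+x. enn_powr (hl_max f1 x) p \<partial>lebesgue) \<le> ennreal A * ennreal (F powr p * (3 * l) powr lam)"
        by (simp add: mult_left_mono)
    qed
    also have "\<dots> = ennreal (A * (F powr p * (3 * l) powr lam) + s powr p * l ^ DIM('a))"
      using A l by (simp add: ennreal_plus flip: ennreal_mult)
    also have "s powr p * l ^ DIM('a) = 2 powr p * F powr p * (l powr (lam - DIM('a)) * l powr DIM('a))"
      using p l F by (simp add: s_def powr_mult powr_powr powr_realpow)
    also have "\<dots> = 2 powr p * F powr p * l powr lam" by (simp flip: powr_add)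
    also have "A * (F powr p * (3 * l) powr lam) + 2 powr p * F powr p * l powr lam =
       (A * 3 powr lam + 2 powr p) * F powr p * l powr lam"
      using l by (simp add: powr_mult algebra_simps)
    finally show "(\<integral>\<^sup>+x\<in>cube a l. enn_powr (hl_max f x) p \<partial>lebesgue)
        \<le> ennreal ((A * 3 powr lam + 2 powr p) * F powr p * l powr lam)" .
  qed
qed

section \<open>Mean oscillation and Hoelder continuity\<close>

text \<open>By homogeneity the sum may be scaled to 1, and there
  \<open>u \<le> u powr \<beta>\<close>. This is the triangle inequality for the metric in the
  extension below.\<close>

lemma powr_add_le_add_powr:
  fixes s t \<beta> :: real
  assumes "s \<ge> 0" "t \<ge> 0" "0 < \<beta>" "\<beta> \<le> 1"
  shows "(s + t) powr \<beta> \<le> s powr \<beta> + t powr \<beta>"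
proof (cases "s + t = 0")
  case False
  hence pos: "s + t > 0" using assms by linarith
  have *: "u \<le> u powr \<beta>" if "0 \<le> u" "u \<le> 1" for u :: real
    using powr_mono'[of \<beta> 1 u] that assms by simp
  have "1 = s / (s + t) + t / (s + t)" using pos by (simp flip: add_divide_distrib)
  also have "\<dots> \<le> (s / (s + t)) powr \<beta> + (t / (s + t)) powr \<beta>"
    using pos assms by (intro add_mono *) auto
  also have "\<dots> = (s powr \<beta> + t powr \<beta>) / (s + t) powr \<beta>"
    using pos assms by (simp add: powr_divide add_divide_distrib)
  finally show ?thesis using pos by (simp add: field_simps)
qed (use assms in auto)

text \<open>McShane's extension, for the metric \<open>\<parallel>x - y\<parallel>\<^sup>\<beta>\<close>.\<close>

lemma hoelder_extension:
  fixes b :: "'a::real_normed_vector \<Rightarrow> real"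
  assumes \<beta>: "0 < \<beta>" "\<beta> \<le> 1" and S: "S \<noteq> {}" and L: "L \<ge> 0"
    and le: "\<And>x y. x \<in> S \<Longrightarrow> y \<in> S \<Longrightarrow> \<bar>b x - b y\<bar> \<le> L * norm (x - y) powr \<beta>"
  obtains g where "\<And>x. x \<in> S \<Longrightarrow> g x = b x" "\<And>x y. \<bar>g x - g y\<bar> \<le> L * norm (x - y) powr \<beta>"
proof
  define g where "g x = (INF y\<in>S. b y + L * norm (x - y) powr \<beta>)" for x
  have tri: "L * norm (x - y) powr \<beta> \<le> L * norm (x - z) powr \<beta> + L * norm (z - y) powr \<beta>" for x y z
  proof -
    have "norm (x - y) powr \<beta> \<le> (norm (x - z) + norm (z - y)) powr \<beta>"
      using \<beta> norm_triangle_ineq[of "x - z" "z - y"] by (intro powr_mono2) auto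
    also have "\<dots> \<le> norm (x - z) powr \<beta> + norm (z - y) powr \<beta>"
      using \<beta> by (intro powr_add_le_add_powr) auto
    finally show ?thesis using L by (simp add: mult_left_mono flip: distrib_left)
  qed
  obtain y0 where y0: "y0 \<in> S" using S by blast
  have bdd: "bdd_below ((\<lambda>y. b y + L * norm (x - y) powr \<beta>) ` S)" for x
  proof (rule bdd_belowI2)
    fix y assume y: "y \<in> S"
    show "b y0 - L * norm (y0 - x) powr \<beta> \<le> b y + L * norm (x - y) powr \<beta>"
      using le[OF y0 y] tri[of y0 y x] by linarith
  qed
  show "g x = b x" if x: "x \<in> S" for x
  proof (rule antisym)
    \<comment> \<open>The competitor \<open>y = x\<close> has value \<open>b x\<close>, because
      \<open>0 powr \<beta> = 0\<close>.\<close>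
    show "g x \<le> b x" unfolding g_def using cINF_lower[OF bdd x, of x] by simp
    show "b x \<le> g x" unfolding g_def
    proof (rule cINF_greatest[OF S])
      fix y assume "y \<in> S"
      with le[OF x this] show "b x \<le> b y + L * norm (x - y) powr \<beta>" by linarith
    qed
  qed
  \<comment> \<open>Moving a competitor from \<open>z\<close> to \<open>x\<close> costs at most the
    distance term, by \<open>tri\<close>.\<close>
  have half: "g x - L * norm (x - z) powr \<beta> \<le> g z" for x z
    unfolding g_def[of z]
  proof (rule cINF_greatest[OF S])
    fix y assume y: "y \<in> S"
    have "g x \<le> b y + L * norm (x - y) powr \<beta>" unfolding g_def by (rule cINF_lower[OF bdd y])
    with tri[of x y z] show "g x - L * norm (x - z) powr \<beta> \<le> b y + L * norm (z - y) powr \<beta>" by linarith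
  qed
  show "\<bar>g x - g z\<bar> \<le> L * norm (x - z) powr \<beta>" for x z
    using half[of x z] half[of z x] by (simp add: norm_minus_commute abs_le_iff)
qed

section \<open>Averages over cubes and Campanato's argument\<close>

lemma locally_integrable_cbox:
  assumes "locally_integrable b"
  shows "b absolutely_integrable_on cbox a c"
  using assms compact_cbox unfolding locally_integrable_def by blast

text \<open>Passes between the nonnegative Lebesgue integral of the definitions and the gauge
  integral in which averages and oscillations are written.\<close>

lemma set_nn_integral_eq_integral:
  fixes u :: "'a::euclidean_space \<Rightarrow> real"
  assumes "u integrable_on S" "\<And>x. x \<in> S \<Longrightarrow> u x \<ge> 0"
  shows "(\<integral>\<^sup>+x\<in>S. ennreal (u x) \<partial>lebesgue) = ennreal (integral S u)"
  unfolding nn_integral_completion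
  by (rule nn_integral_has_integral_lebesgue') (use assms in \<open>auto intro: integrable_integral\<close>)

definition cube_avg :: "('a::euclidean_space \<Rightarrow> real) \<Rightarrow> 'a \<Rightarrow> real \<Rightarrow> real" where
  "cube_avg b a l = integral (cube a l) b / l ^ DIM('a)"

text \<open>The difference is the average over the smaller cube of
  \<open>b - cube_avg b a l\<close>, whose absolute value is integrated over the larger cube
  instead.\<close>

lemma cube_avg_diff_le:
  fixes b :: "'a::euclidean_space \<Rightarrow> real"
  assumes b: "locally_integrable b" and l: "l' > 0"
    and sub: "cube a' l' \<subseteq> cube a l"
    and osc: "integral (cube a l) (\<lambda>x. \<bar>b x - cube_avg b a l\<bar>) \<le> R"
  shows "\<bar>cube_avg b a' l' - cube_avg b a l\<bar> \<le> R / l' ^ DIM('a)"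
proof -
  define c where "c = cube_avg b a l"
  have int: "(\<lambda>x. b x - c) absolutely_integrable_on cbox u v" for u v
    using locally_integrable_cbox[OF b]
    by (intro set_integral_diff absolutely_integrable_on_const) auto
  have int': "(\<lambda>x. b x - c) integrable_on cbox u v" "(\<lambda>x. \<bar>b x - c\<bar>) integrable_on cbox u v" for u v
    using int[of u v] unfolding absolutely_integrable_on_def by auto
  have bi: "b integrable_on cbox u v" for u v
    using locally_integrable_cbox[OF b] set_lebesgue_integral_eq_integral(1) by blast
  have "integral (cube a' l') (\<lambda>x. b x - c) = integral (cube a' l') b - c * l' ^ DIM('a)"
    using l bi measure_cube[of l' a'] by (subst integral_diff) auto
  hence "cube_avg b a' l' - c = integral (cube a' l') (\<lambda>x. b x - c) / l' ^ DIM('a)"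
    using l by (simp add: cube_avg_def field_simps)
  moreover have "norm (integral (cube a' l') (\<lambda>x. b x - c)) \<le> integral (cube a' l') (\<lambda>x. \<bar>b x - c\<bar>)"
    by (rule integral_norm_bound_integral) (use int' in auto)
  moreover have "integral (cube a' l') (\<lambda>x. \<bar>b x - c\<bar>) \<le> integral (cube a l) (\<lambda>x. \<bar>b x - c\<bar>)"
    using sub int' by (intro integral_subset_le) auto
  ultimately show ?thesis using osc l unfolding c_def[symmetric]
    by (simp add: divide_right_mono)
qed

text \<open>Averages over successively halved cubes at \<open>x\<close> differ by terms of a
  geometric series and converge to \<open>b x\<close> outside a null set. So \<open>b x\<close> is
  within a multiple of \<open>h powr \<beta>\<close> of the average over \<open>cube x h\<close>.
  For two points at distance \<open>h\<close>, these two cubes lie in one cube of side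
  \<open>3 * h\<close>, which links their averages. The estimate on the complement of the null set
  is then extended to the whole space.\<close>

lemma campanato:
  fixes b :: "'a::euclidean_space \<Rightarrow> real" and \<beta> K :: real
  assumes b: "locally_integrable b" and \<beta>: "0 < \<beta>" "\<beta> \<le> 1" and K: "K \<ge> 0"
    and osc: "\<And>a l. l > 0 \<Longrightarrow>
      integral (cube a l) (\<lambda>x. \<bar>b x - cube_avg b a l\<bar>) \<le> K * l powr (DIM('a) + \<beta>)"
  shows "\<exists>g\<in>lipschitz_space \<beta>. AE x in lebesgue. b x = g x"
proof -
  define n where "n = DIM('a)"
  have bi: "b integrable_on cbox u v" for u v
    using locally_integrable_cbox[OF b] set_lebesgue_integral_eq_integral(1) by blast
  \<comment> \<open>Lebesgue differentiation along cubes having \<open>x\<close> as lower corner,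
    not as centre.\<close>
  obtain N where N: "negligible N" "\<And>x e. \<lbrakk>x \<notin> N; 0 < e\<rbrakk> \<Longrightarrow>
       \<exists>d>0. \<forall>h. 0 < h \<and> h < d \<longrightarrow> norm (integral (cube x h) b /\<^sub>R h ^ DIM('a) - b x) < e"
    using integrable_ccontinuous_explicit[OF bi] by blast
  have avg: "\<bar>cube_avg b a' l' - cube_avg b a l\<bar> \<le> K * (l / l') ^ n * l powr \<beta>"
    if "l' > 0" "l > 0" "cube a' l' \<subseteq> cube a l" for a a' :: 'a and l l'
    using cube_avg_diff_le[OF b that(1,3) osc[OF that(2)]] that
    by (simp add: powr_add powr_realpow n_def power_divide mult_ac)
  \<comment> \<open>Halving the side multiplies the oscillation bound by \<open>r\<close>, and
    \<open>2 ^ n\<close> is the volume ratio of consecutive cubes; \<open>D\<close> bounds the sum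
    of the series.\<close>
  define r where "r = 2 powr (- \<beta>)"
  have r: "0 < r" "r < 1" using \<beta> by (auto simp: r_def powr_less_one)
  define D where "D = K * 2 ^ n / (1 - r)"
  have D: "D \<ge> 0" using K r by (simp add: D_def)
  have step: "\<bar>cube_avg b x h - cube_avg b x (h / 2 ^ k)\<bar> \<le> K * 2 ^ n * h powr \<beta> * (\<Sum>j<k. r ^ j)"
    if h: "h > 0" for x h k
  proof (induction k)
    case (Suc k)
    have sub: "cube x (h / 2 ^ Suc k) \<subseteq> cube x (h / 2 ^ k)"
      using h by (auto simp: subset_box inner_add_left divide_left_mono)
    have "(h / 2 ^ k) powr \<beta> = h powr \<beta> / (2 powr k) powr \<beta>"
      using h by (simp add: powr_divide powr_realpow)
    also have "\<dots> = h powr \<beta> * (2 powr (- \<beta>)) powr k"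
      using powr_minus_divide[of 2 "\<beta> * k"] by (simp add: powr_powr mult.commute)
    also have "\<dots> = h powr \<beta> * r ^ k"
      using r by (simp add: r_def powr_realpow)
    finally have "(h / 2 ^ k) powr \<beta> = h powr \<beta> * r ^ k" .
    moreover have "(h / 2 ^ k) / (h / 2 ^ Suc k) = 2" using h by simp
    ultimately have "\<bar>cube_avg b x (h / 2 ^ Suc k) - cube_avg b x (h / 2 ^ k)\<bar> \<le> K * 2 ^ n * (h powr \<beta> * r ^ k)"
      using avg[OF _ _ sub] h by simp
    with Suc show ?case by (simp add: algebra_simps)
  qed simp
  have lim: "(\<lambda>k. cube_avg b x (h / 2 ^ k)) \<longlonglongrightarrow> b x" if x: "x \<notin> N" and h: "h > 0" for x h
  proof (rule LIMSEQ_I)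
    fix e :: real assume "e > 0"
    then obtain d where d: "d > 0" "\<And>h. 0 < h \<Longrightarrow> h < d \<Longrightarrow> norm (integral (cube x h) b /\<^sub>R h ^ DIM('a) - b x) < e"
      using N(2)[OF x \<open>e > 0\<close>] by blast
    have "(\<lambda>k. h * (1 / 2) ^ k) \<longlonglongrightarrow> h * 0"
      by (rule tendsto_mult[OF tendsto_const LIMSEQ_power_zero]) simp
    hence "\<forall>\<^sub>F k in sequentially. h * (1 / 2) ^ k < d"
      using d by (intro order_tendstoD) auto
    then obtain k0 where k0: "\<And>k. k \<ge> k0 \<Longrightarrow> h * (1 / 2) ^ k < d"
      unfolding eventually_sequentially by blast
    have "norm (cube_avg b x (h / 2 ^ k) - b x) < e" if "k \<ge> k0" for k
    proof -
      have "h / 2 ^ k < d" using k0[OF that] by (simp add: power_divide)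
      moreover have "0 < h / 2 ^ k" using h by simp
      ultimately have "norm (integral (cube x (h / 2 ^ k)) b /\<^sub>R (h / 2 ^ k) ^ DIM('a) - b x) < e"
        using d(2) by blast
      moreover have "integral (cube x (h / 2 ^ k)) b /\<^sub>R (h / 2 ^ k) ^ DIM('a) = cube_avg b x (h / 2 ^ k)"
        unfolding cube_avg_def real_scaleR_def by (subst mult.commute) (rule divide_inverse[symmetric])
      ultimately show ?thesis by (simp only:)
    qed
    thus "\<exists>k0. \<forall>k\<ge>k0. norm (cube_avg b x (h / 2 ^ k) - b x) < e" by blast
  qed
  have pt: "\<bar>cube_avg b x h - b x\<bar> \<le> D * h powr \<beta>" if x: "x \<notin> N" and h: "h > 0" for x h
  proof (rule LIMSEQ_le_const2)
    show "(\<lambda>k. \<bar>cube_avg b x h - cube_avg b x (h / 2 ^ k)\<bar>) \<longlonglongrightarrow> \<bar>cube_avg b x h - b x\<bar>"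
      by (rule tendsto_rabs[OF tendsto_diff[OF tendsto_const lim[OF x h]]])
    show "\<exists>k0. \<forall>k\<ge>k0. \<bar>cube_avg b x h - cube_avg b x (h / 2 ^ k)\<bar> \<le> D * h powr \<beta>"
    proof (intro exI allI impI)
      fix k
      have "(\<Sum>j<k. r ^ j) \<le> 1 / (1 - r)"
        using r by (simp add: sum_gp_strict divide_right_mono)
      hence "K * 2 ^ n * h powr \<beta> * (\<Sum>j<k. r ^ j) \<le> K * 2 ^ n * h powr \<beta> * (1 / (1 - r))"
        using K by (intro mult_left_mono) auto
      with step[OF h, of x k] show "\<bar>cube_avg b x h - cube_avg b x (h / 2 ^ k)\<bar> \<le> D * h powr \<beta>"
        by (simp add: D_def)
    qed
  qed
  \<comment> \<open>One \<open>D\<close> for each passage from a point to its average, and one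
    \<open>K * 3 ^ n * 3 powr \<beta>\<close> for each passage to the common cube.\<close>
  define L where "L = 2 * D + 2 * (K * 3 ^ n * 3 powr \<beta>)"
  have L: "L \<ge> 0" using D K by (simp add: L_def)
  have main: "\<bar>b x - b y\<bar> \<le> L * norm (x - y) powr \<beta>" if "x \<in> - N" "y \<in> - N" for x y
  proof (cases "x = y")
    case False
    define h where "h = norm (x - y)"
    have h: "h > 0" using False by (simp add: h_def)
    \<comment> \<open>The common cube runs from \<open>x - h\<close> to \<open>x + 2 * h\<close> in
      every coordinate. It contains \<open>cube y h\<close>, since the coordinates of
      \<open>y\<close> are within \<open>h\<close> of those of \<open>x\<close>.\<close>
    define a where "a = x - h *\<^sub>R One"
    have xy: "\<bar>x \<bullet> i - y \<bullet> i\<bar> \<le> h" if "i \<in> Basis" for i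
      using Basis_le_norm[OF that, of "x - y"] by (simp add: h_def inner_diff_left)
    have "cube z h \<subseteq> cube a (3 * h)" if z: "\<And>i. i \<in> Basis \<Longrightarrow> \<bar>x \<bullet> i - z \<bullet> i\<bar> \<le> h" for z
    proof
      fix w assume w: "w \<in> cube z h"
      show "w \<in> cube a (3 * h)" unfolding mem_cube
      proof
        fix i :: 'a assume i: "i \<in> Basis"
        have "a \<bullet> i = x \<bullet> i - h" using i by (simp add: a_def inner_diff_left)
        moreover have "z \<bullet> i \<le> w \<bullet> i" "w \<bullet> i \<le> z \<bullet> i + h" using w i by (auto simp: mem_cube)
        ultimately show "a \<bullet> i \<le> w \<bullet> i \<and> w \<bullet> i \<le> a \<bullet> i + 3 * h"
          using z[OF i] unfolding abs_le_iff by linarith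
      qed
    qed
    from this[of x] this[of y] xy h
    have "cube x h \<subseteq> cube a (3 * h)" "cube y h \<subseteq> cube a (3 * h)" by auto
    from avg[OF _ _ this(1)] avg[OF _ _ this(2)] h
    have "\<bar>cube_avg b x h - cube_avg b a (3 * h)\<bar> \<le> K * 3 ^ n * 3 powr \<beta> * h powr \<beta>"
         "\<bar>cube_avg b y h - cube_avg b a (3 * h)\<bar> \<le> K * 3 ^ n * 3 powr \<beta> * h powr \<beta>"
      by (auto simp: powr_mult)
    moreover have "\<bar>cube_avg b x h - b x\<bar> \<le> D * h powr \<beta>" "\<bar>cube_avg b y h - b y\<bar> \<le> D * h powr \<beta>"
      using pt h that by auto
    ultimately show ?thesis unfolding L_def h_def[symmetric] by (simp add: algebra_simps)
  qed simp
  have ne: "- N \<noteq> {}" using N(1) non_negligible_UNIV by (metis Compl_empty_eq double_complement)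
  have "\<exists>g. (\<forall>x\<in>-N. g x = b x) \<and> (\<forall>x y. \<bar>g x - g y\<bar> \<le> L * norm (x - y) powr \<beta>)"
    by (rule hoelder_extension[OF \<beta> ne L main]) auto
  then obtain g where g: "\<And>x. x \<in> - N \<Longrightarrow> g x = b x" "\<And>x y. \<bar>g x - g y\<bar> \<le> L * norm (x - y) powr \<beta>"
    by auto
  have "AE x in lebesgue. x \<notin> N"
    using N(1) by (simp add: AE_not_in negligible_iff_null_sets)
  hence "AE x in lebesgue. b x = g x" by eventually_elim (use g(1) in auto)
  thus ?thesis using g(2) unfolding lipschitz_space_def by blast
qed

text \<open>The averages of the negative part over cubes of side \<open>h\<close> are at most
  \<open>K * h powr \<beta>\<close>, which tends to 0; by Lebesgue differentiation the negative part
  vanishes almost everywhere.\<close>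

lemma AE_nonneg_of_cube_integrals:
  fixes b :: "'a::euclidean_space \<Rightarrow> real" and \<beta> K :: real
  assumes b: "locally_integrable b" and \<beta>: "0 < \<beta>" and K: "K \<ge> 0"
    and le: "\<And>a l. l > 0 \<Longrightarrow> integral (cube a l) (\<lambda>x. max 0 (- b x)) \<le> K * l powr (DIM('a) + \<beta>)"
  shows "AE x in lebesgue. 0 \<le> b x"
proof -
  define u where "u = (\<lambda>x. max 0 (- b x))"
  have "u absolutely_integrable_on cbox v w" for v w
    using locally_integrable_cbox[OF b, of v w] unfolding u_def
    by (intro absolutely_integrable_max_1) (simp_all add: set_integrable_def)
  hence ui: "u integrable_on cbox v w" for v w
    using set_lebesgue_integral_eq_integral(1) by blast
  obtain N where N: "negligible N" "\<And>x e. \<lbrakk>x \<notin> N; 0 < e\<rbrakk> \<Longrightarrow>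
       \<exists>d>0. \<forall>h. 0 < h \<and> h < d \<longrightarrow> norm (integral (cube x h) u /\<^sub>R h ^ DIM('a) - u x) < e"
    using integrable_ccontinuous_explicit[OF ui] by blast
  have "u x \<le> 0" if x: "x \<notin> N" for x
  proof (rule field_le_epsilon)
    fix e :: real assume e: "e > 0"
    then obtain d where d: "d > 0" "\<And>h. 0 < h \<Longrightarrow> h < d \<Longrightarrow> norm (integral (cube x h) u /\<^sub>R h ^ DIM('a) - u x) < e / 2"
      using N(2)[OF x, of "e / 2"] by auto
    \<comment> \<open>Small enough for the differentiation estimate and for
      \<open>K * h powr \<beta> \<le> e / 2\<close>; \<open>K + 1\<close> avoids division by
      0.\<close>
    define h where "h = min (d / 2) ((e / (2 * (K + 1))) powr (1 / \<beta>))"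
    have h: "h > 0" "h < d" using d e K by (auto simp: h_def)
    have "h powr \<beta> \<le> ((e / (2 * (K + 1))) powr (1 / \<beta>)) powr \<beta>"
      using h \<beta> by (intro powr_mono2) (auto simp: h_def)
    also have "\<dots> = e / (2 * (K + 1))" using e K \<beta> by (simp add: powr_powr)
    finally have "K * h powr \<beta> \<le> K * (e / (2 * (K + 1)))" using K by (intro mult_left_mono)
    also have "\<dots> \<le> e / 2" using K e by (simp add: field_simps)
    finally have "K * h powr \<beta> \<le> e / 2" .
    moreover have "integral (cube x h) u /\<^sub>R h ^ DIM('a) \<le> K * h powr \<beta>"
      using le[OF h(1), of x] h
      by (simp add: u_def powr_add powr_realpow field_simps)
    ultimately show "u x \<le> 0 + e" using d(2)[OF h] unfolding real_norm_def by linarith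
  qed
  moreover have "AE x in lebesgue. x \<notin> N"
    using N(1) by (simp add: AE_not_in negligible_iff_null_sets)
  ultimately show ?thesis
    by (auto simp: u_def elim!: eventually_mono)
qed

section \<open>Hoelder continuity implies boundedness\<close>

lemma borel_measurable_hoelder:
  fixes g :: "'a::euclidean_space \<Rightarrow> real"
  assumes le: "\<And>x y. \<bar>g x - g y\<bar> \<le> C * norm (x - y) powr \<beta>" and "\<beta> > 0"
  shows "g \<in> borel_measurable lebesgue"
proof -
  have "isCont g x" for x
    unfolding isCont_def
  proof (rule Lim_transform_bound[where g = "\<lambda>y. C * norm (y - x) powr \<beta>", THEN LIM_zero_cancel])
    show "\<forall>\<^sub>F y in at x. norm (g y - g x) \<le> norm (C * norm (y - x) powr \<beta>)"
      using le by (intro always_eventually allI) (metis abs_ge_self order_trans real_norm_def)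
    have "((\<lambda>y. C * norm (y - x) powr \<beta>) \<longlongrightarrow> C * 0 powr \<beta>) (at x)"
      by (rule tendsto_mult[OF tendsto_const tendsto_powr2])
         (use assms in \<open>auto intro!: tendsto_eq_intros always_eventually\<close>)
    thus "((\<lambda>y. C * norm (y - x) powr \<beta>) \<longlongrightarrow> 0) (at x)" by simp
  qed
  hence "g \<in> borel_measurable borel"
    by (intro borel_measurable_continuous_onI continuous_at_imp_continuous_on) auto
  thus ?thesis by (simp add: measurable_completion)
qed

text \<open>Hoelder continuity leaves \<open>l powr \<beta>\<close> times the average
  \<open>v\<close> of |f|. Writing \<open>v\<close> as \<open>v powr (1 - e) * v powr e\<close>, the
  first factor is bounded through the maximal function and the second through the Morrey norm. Under
  the exponent relation of the theorem, \<open>e\<close> is \<open>1 - p / q\<close>.\<close>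

lemma cube_oscillation_le:
  fixes f g :: "'a::euclidean_space \<Rightarrow> real" and p lam \<beta> C F m :: real
  assumes f [measurable]: "f \<in> borel_measurable lebesgue"
    and C: "C \<ge> 0" "\<And>x y. \<bar>g x - g y\<bar> \<le> C * norm (x - y) powr \<beta>"
    and p: "p > 1" and \<beta>: "0 < \<beta>" and lam: "lam < DIM('a) - \<beta> * p"
    and m: "hl_max f x = ennreal m" "m \<ge> 0" and F: "F \<ge> 0"
    and morrey: "\<And>a l. l > 0 \<Longrightarrow> (\<integral>\<^sup>+x\<in>cube a l. ennreal (\<bar>f x\<bar> powr p) \<partial>lebesgue) \<le> ennreal (F powr p * l powr lam)"
    and x: "x \<in> cube a l" and l: "l > 0" and e: "e = p * \<beta> / (DIM('a) - lam)"
  shows "(\<integral>\<^sup>+y\<in>cube a l. ennreal (\<bar>g y - g x\<bar> * \<bar>f y\<bar>) \<partial>lebesgue)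
    \<le> ennreal (C * DIM('a) powr \<beta> * (m powr (1 - e) * (2 * F) powr e)) * ennreal (l ^ DIM('a))"
proof -
  define I where "I = (\<integral>\<^sup>+y\<in>cube a l. ennreal \<bar>f y\<bar> \<partial>lebesgue)"
  have n: "real DIM('a) - lam > 0" using lam p \<beta> by (smt (verit) mult_pos_pos)
  have e01: "0 < e" "e < 1" using lam p \<beta> n by (auto simp: e field_simps)
  have I1: "I \<le> ennreal m * ennreal (l ^ DIM('a))"
    unfolding I_def m(1)[symmetric] by (intro cube_average_le_hl_max l x)
  have I2: "I \<le> ennreal (2 * F * l powr ((lam - DIM('a)) / p)) * ennreal (l ^ DIM('a))"
    unfolding I_def by (intro morrey_cube_average f p F l morrey)
  have "I \<noteq> top" using I1 by (metis ennreal_mult_less_top ennreal_less_top leD top.not_eq_extremum)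
  then obtain i where i: "I = ennreal i" "i \<ge> 0" by (cases I) auto
  define v where "v = i / l ^ DIM('a)"
  have v: "v \<ge> 0" "i = v * l ^ DIM('a)" using i l by (auto simp: v_def)
  have v1: "v \<le> m"
    using I1 i m(2) l by (simp add: v_def field_simps flip: ennreal_mult)
  have v2: "v \<le> 2 * F * l powr ((lam - DIM('a)) / p)"
    using I2 i F l by (simp add: v_def field_simps flip: ennreal_mult)
  have "l powr \<beta> * v \<le> m powr (1 - e) * (2 * F) powr e"
  proof (cases "v = 0")
    case False
    hence "v = v powr (1 - e) * v powr e" using v by (simp flip: powr_add)
    also have "\<dots> \<le> m powr (1 - e) * (2 * F * l powr ((lam - DIM('a)) / p)) powr e"
      using v v1 v2 e01 by (intro mult_mono powr_mono2) auto
    also have "\<dots> = m powr (1 - e) * (2 * F) powr e * l powr ((lam - DIM('a)) / p * e)"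
      using F by (simp add: powr_mult powr_powr)
    \<comment> \<open>The value of \<open>e\<close> is dictated by this cancellation of all powers
      of \<open>l\<close>.\<close>
    also have "(lam - DIM('a)) / p * e = - \<beta>" using n p by (simp add: e divide_simps) (simp add: algebra_simps)
    finally have "l powr \<beta> * v \<le> l powr \<beta> * (m powr (1 - e) * (2 * F) powr e * l powr (- \<beta>))"
      by (intro mult_left_mono) auto
    also have "\<dots> = m powr (1 - e) * (2 * F) powr e" using l by (simp add: powr_minus)
    finally show ?thesis .
  qed simp
  hence *: "C * DIM('a) powr \<beta> * (l powr \<beta> * v) * l ^ DIM('a)
      \<le> C * DIM('a) powr \<beta> * (m powr (1 - e) * (2 * F) powr e) * l ^ DIM('a)"
    using C l by (intro mult_right_mono mult_left_mono) auto
  have "(\<integral>\<^sup>+y\<in>cube a l. ennreal (\<bar>g y - g x\<bar> * \<bar>f y\<bar>) \<partial>lebesgue)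
     \<le> (\<integral>\<^sup>+y. ennreal (C * (DIM('a) * l) powr \<beta>) * (ennreal \<bar>f y\<bar> * indicator (cube a l) y) \<partial>lebesgue)"
  proof (rule nn_integral_mono)
    fix y
    show "ennreal (\<bar>g y - g x\<bar> * \<bar>f y\<bar>) * indicator (cube a l) y
      \<le> ennreal (C * (DIM('a) * l) powr \<beta>) * (ennreal \<bar>f y\<bar> * indicator (cube a l) y)"
    proof (cases "y \<in> cube a l")
      case True
      have "\<bar>g y - g x\<bar> \<le> C * norm (y - x) powr \<beta>" by (rule C)
      also have "\<dots> \<le> C * (DIM('a) * l) powr \<beta>"
        using C \<beta> norm_diff_le_cube[OF True x] by (intro mult_left_mono powr_mono2) auto
      finally have "\<bar>g y - g x\<bar> * \<bar>f y\<bar> \<le> C * (DIM('a) * l) powr \<beta> * \<bar>f y\<bar>"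
        by (rule mult_right_mono) simp
      thus ?thesis using True C by (simp add: ennreal_leI flip: ennreal_mult)
    qed simp
  qed
  also have "\<dots> = ennreal (C * (DIM('a) * l) powr \<beta>) * I"
    unfolding I_def by (subst nn_integral_cmult) auto
  also have "\<dots> = ennreal (C * DIM('a) powr \<beta> * (l powr \<beta> * v) * l ^ DIM('a))"
    using C l v by (simp add: i powr_mult mult_ac flip: ennreal_mult)
  also have "\<dots> \<le> ennreal (C * DIM('a) powr \<beta> * (m powr (1 - e) * (2 * F) powr e) * l ^ DIM('a))"
    by (rule ennreal_leI) (rule *)
  also have "\<dots> = ennreal (C * DIM('a) powr \<beta> * (m powr (1 - e) * (2 * F) powr e)) * ennreal (l ^ DIM('a))"
    using C l by (intro ennreal_mult) auto
  finally show ?thesis .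
qed

text \<open>On each cube \<open>|g y|\<close> and \<open>g x\<close> differ by at most
  \<open>|g y - g x|\<close>; multiplying by |f| and averaging gives both bounds. The second is
  stated with a sum, as subtraction in \<open>ennreal\<close> truncates.\<close>

lemma hl_max_mult_close:
  fixes f g :: "'a::euclidean_space \<Rightarrow> real"
  assumes [measurable]: "f \<in> borel_measurable lebesgue" "g \<in> borel_measurable lebesgue"
    and m: "hl_max f x = ennreal m" "m \<ge> 0" and g: "g x \<ge> 0" and S: "S \<ge> 0"
    and osc: "\<And>a l. l > 0 \<Longrightarrow> x \<in> cube a l \<Longrightarrow>
      (\<integral>\<^sup>+y\<in>cube a l. ennreal (\<bar>g y - g x\<bar> * \<bar>f y\<bar>) \<partial>lebesgue) \<le> ennreal S * ennreal (l ^ DIM('a))"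
  shows "hl_max (\<lambda>y. g y * f y) x \<le> ennreal (g x * m + S)"
    and "ennreal (g x * m) \<le> hl_max (\<lambda>y. g y * f y) x + ennreal S"
proof -
  show "hl_max (\<lambda>y. g y * f y) x \<le> ennreal (g x * m + S)"
    unfolding hl_max_le_iff
  proof safe
    fix a :: 'a and l :: real assume l: "l > 0" "x \<in> cube a l"
    have "(\<integral>\<^sup>+y\<in>cube a l. ennreal \<bar>g y * f y\<bar> \<partial>lebesgue) \<le>
       (\<integral>\<^sup>+y. ennreal (g x) * (ennreal \<bar>f y\<bar> * indicator (cube a l) y) +
          ennreal (\<bar>g y - g x\<bar> * \<bar>f y\<bar>) * indicator (cube a l) y \<partial>lebesgue)"
    proof (rule nn_integral_mono)
      fix y
      have "\<bar>g y\<bar> * \<bar>f y\<bar> \<le> (g x + \<bar>g y - g x\<bar>) * \<bar>f y\<bar>" using g by (intro mult_right_mono) auto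
      hence "ennreal \<bar>g y * f y\<bar> \<le> ennreal (g x) * ennreal \<bar>f y\<bar> + ennreal (\<bar>g y - g x\<bar> * \<bar>f y\<bar>)"
        using g by (simp add: abs_mult distrib_right ennreal_leI flip: ennreal_mult ennreal_plus)
      thus "ennreal \<bar>g y * f y\<bar> * indicator (cube a l) y \<le> ennreal (g x) * (ennreal \<bar>f y\<bar> * indicator (cube a l) y) +
          ennreal (\<bar>g y - g x\<bar> * \<bar>f y\<bar>) * indicator (cube a l) y"
        by (auto simp: indicator_def)
    qed
    also have "\<dots> = ennreal (g x) * (\<integral>\<^sup>+y\<in>cube a l. ennreal \<bar>f y\<bar> \<partial>lebesgue) +
        (\<integral>\<^sup>+y\<in>cube a l. ennreal (\<bar>g y - g x\<bar> * \<bar>f y\<bar>) \<partial>lebesgue)"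
      by (subst nn_integral_add) (auto simp: nn_integral_cmult)
    also have "\<dots> \<le> ennreal (g x) * (ennreal m * ennreal (l ^ DIM('a))) + ennreal S * ennreal (l ^ DIM('a))"
      using cube_average_le_hl_max[of l x a f] l by (intro add_mono mult_left_mono osc) (auto simp: m)
    also have "\<dots> = ennreal (g x * m + S) * ennreal (l ^ DIM('a))"
      using g m S l by (simp add: ennreal_mult ennreal_plus distrib_right mult.assoc)
    finally show "(\<integral>\<^sup>+y\<in>cube a l. ennreal \<bar>g y * f y\<bar> \<partial>lebesgue) \<le> ennreal (g x * m + S) * ennreal (l ^ DIM('a))" .
  qed
  let ?H = "hl_max (\<lambda>y. g y * f y) x"
  show "ennreal (g x * m) \<le> ?H + ennreal S"
  proof (cases "g x = 0")
    case False
    hence gx: "g x > 0" using g by simp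
    \<comment> \<open>The bound on each cube is divided by \<open>g x > 0\<close> in order to become
      a bound on the supremum defining \<open>hl_max f x\<close>.\<close>
    have "hl_max f x \<le> ennreal (1 / g x) * (?H + ennreal S)"
      unfolding hl_max_le_iff
    proof safe
      fix a :: 'a and l :: real assume l: "l > 0" "x \<in> cube a l"
      have "ennreal (g x) * (\<integral>\<^sup>+y\<in>cube a l. ennreal \<bar>f y\<bar> \<partial>lebesgue) =
         (\<integral>\<^sup>+y. ennreal (g x) * (ennreal \<bar>f y\<bar> * indicator (cube a l) y) \<partial>lebesgue)"
        by (simp add: nn_integral_cmult)
      also have "\<dots> \<le> (\<integral>\<^sup>+y. ennreal \<bar>g y * f y\<bar> * indicator (cube a l) y +
          ennreal (\<bar>g y - g x\<bar> * \<bar>f y\<bar>) * indicator (cube a l) y \<partial>lebesgue)"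
      proof (rule nn_integral_mono)
        fix y
        have "g x * \<bar>f y\<bar> \<le> (\<bar>g y\<bar> + \<bar>g y - g x\<bar>) * \<bar>f y\<bar>" by (intro mult_right_mono) auto
        hence "ennreal (g x) * ennreal \<bar>f y\<bar> \<le> ennreal \<bar>g y * f y\<bar> + ennreal (\<bar>g y - g x\<bar> * \<bar>f y\<bar>)"
          using g by (simp add: abs_mult distrib_right ennreal_leI flip: ennreal_mult ennreal_plus)
        thus "ennreal (g x) * (ennreal \<bar>f y\<bar> * indicator (cube a l) y) \<le> ennreal \<bar>g y * f y\<bar> * indicator (cube a l) y +
            ennreal (\<bar>g y - g x\<bar> * \<bar>f y\<bar>) * indicator (cube a l) y"
          by (auto simp: indicator_def)
      qed
      also have "\<dots> = (\<integral>\<^sup>+y\<in>cube a l. ennreal \<bar>g y * f y\<bar> \<partial>lebesgue) +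
          (\<integral>\<^sup>+y\<in>cube a l. ennreal (\<bar>g y - g x\<bar> * \<bar>f y\<bar>) \<partial>lebesgue)"
        by (subst nn_integral_add) auto
      also have "\<dots> \<le> ?H * ennreal (l ^ DIM('a)) + ennreal S * ennreal (l ^ DIM('a))"
        by (intro add_mono osc cube_average_le_hl_max l)
      finally have le: "ennreal (g x) * (\<integral>\<^sup>+y\<in>cube a l. ennreal \<bar>f y\<bar> \<partial>lebesgue)
        \<le> (?H + ennreal S) * ennreal (l ^ DIM('a))" by (simp add: distrib_right)
      have "(\<integral>\<^sup>+y\<in>cube a l. ennreal \<bar>f y\<bar> \<partial>lebesgue)
          = ennreal (1 / g x) * (ennreal (g x) * (\<integral>\<^sup>+y\<in>cube a l. ennreal \<bar>f y\<bar> \<partial>lebesgue))"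
        using gx by (simp add: mult.assoc[symmetric] flip: ennreal_mult)
      also have "\<dots> \<le> ennreal (1 / g x) * ((?H + ennreal S) * ennreal (l ^ DIM('a)))"
        by (intro mult_left_mono le) simp
      finally show "(\<integral>\<^sup>+y\<in>cube a l. ennreal \<bar>f y\<bar> \<partial>lebesgue)
          \<le> ennreal (1 / g x) * (?H + ennreal S) * ennreal (l ^ DIM('a))" by (simp add: mult.assoc)
    qed
    hence "ennreal (g x) * ennreal m \<le> ennreal (g x) * (ennreal (1 / g x) * (?H + ennreal S))"
      unfolding m(1) by (rule mult_left_mono) simp
    also have "\<dots> = ?H + ennreal S"
      using gx by (simp add: mult.assoc[symmetric] flip: ennreal_mult)
    finally show ?thesis using g m by (simp add: ennreal_mult)
  qed simp
qed

text \<open>Both maximal functions are finite at \<open>x\<close>, so the commutator there is an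
  ordinary difference of reals.\<close>

lemma commutator_abs_le:
  assumes "hl_max f x = ennreal m" "m \<ge> 0" "S \<ge> 0" "b x \<ge> 0"
    and "hl_max (\<lambda>y. b y * f y) x \<le> ennreal (b x * m + S)"
    and "ennreal (b x * m) \<le> hl_max (\<lambda>y. b y * f y) x + ennreal S"
  shows "e2ennreal \<bar>commutator b f x\<bar> \<le> ennreal S"
proof -
  obtain h where h: "hl_max (\<lambda>y. b y * f y) x = ennreal h" "h \<ge> 0"
    using assms(5) by (cases "hl_max (\<lambda>y. b y * f y) x") (auto simp: top_unique)
  have "h \<le> b x * m + S"
    using assms(2-5) unfolding h(1) by (subst (asm) ennreal_le_iff) auto
  moreover have "b x * m \<le> h + S" using assms(3,6) h by (simp flip: ennreal_plus)
  moreover have "commutator b f x = ereal (b x * m - h)"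
    using assms h by (simp add: commutator_def)
  ultimately show ?thesis by (simp add: abs_le_iff ennreal_leI flip: ennreal.rep_eq)
qed


section \<open>Finiteness almost everywhere and the Morrey bound for the commutator\<close>

lemma AE_lebesgueI_cubes:
  fixes P :: "'a::euclidean_space \<Rightarrow> bool"
  assumes "\<And>a l. l > 0 \<Longrightarrow> AE x in lebesgue. x \<in> cube a l \<longrightarrow> P x"
  shows "AE x in lebesgue. P x"
proof -
  \<comment> \<open>Countably many centred cubes exhaust the space; \<open>Suc k\<close> keeps their
    sides positive.\<close>
  have "AE x in lebesgue. \<forall>k::nat. x \<in> cube (- real (Suc k) *\<^sub>R One) (2 * real (Suc k)) \<longrightarrow> P x"
    unfolding AE_all_countable by (intro allI assms) simp
  thus ?thesis
  proof eventually_elim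
    case (elim x)
    obtain k :: nat where "norm x \<le> real k" using real_arch_simple by blast
    hence k: "norm x \<le> real (Suc k)" by simp
    have "x \<in> cube (- real (Suc k) *\<^sub>R One) (2 * real (Suc k))"
      unfolding mem_cube
    proof
      fix i :: 'a assume i: "i \<in> Basis"
      have "\<bar>x \<bullet> i\<bar> \<le> real (Suc k)" using Basis_le_norm[OF i, of x] k by linarith
      hence "- real (Suc k) \<le> x \<bullet> i \<and> x \<bullet> i \<le> - real (Suc k) + 2 * real (Suc k)"
        unfolding abs_le_iff by simp
      moreover have "(- real (Suc k) *\<^sub>R One) \<bullet> i = - real (Suc k)" using i by simp
      ultimately show "(- real (Suc k) *\<^sub>R One) \<bullet> i \<le> x \<bullet> i \<and>
          x \<bullet> i \<le> (- real (Suc k) *\<^sub>R One) \<bullet> i + 2 * real (Suc k)"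
        by (simp only: simp_thms)
    qed
    thus ?case using elim by blast
  qed
qed

text \<open>Supplies the almost everywhere well-definedness of the commutator.\<close>

lemma hl_max_morrey_finite_AE:
  fixes f :: "'a::euclidean_space \<Rightarrow> real"
  assumes "\<And>a l. l > 0 \<Longrightarrow> (\<integral>\<^sup>+x\<in>cube a l. enn_powr (hl_max f x) p \<partial>lebesgue) < top"
  shows "AE x in lebesgue. hl_max f x \<noteq> top"
proof (rule AE_lebesgueI_cubes)
  fix a :: 'a and l :: real assume "l > 0"
  hence "(\<integral>\<^sup>+x\<in>cube a l. enn_powr (hl_max f x) p \<partial>lebesgue) \<noteq> \<infinity>"
    using assms[of l a] by simp
  hence "AE x in lebesgue. enn_powr (hl_max f x) p * indicator (cube a l) x \<noteq> \<infinity>"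
    by (intro nn_integral_noteq_infinite) auto
  thus "AE x in lebesgue. x \<in> cube a l \<longrightarrow> hl_max f x \<noteq> top"
    by eventually_elim auto
qed

text \<open>Pointwise the commutator is at most \<open>D * F powr e\<close> times the maximal
  function to the power \<open>1 - e\<close>. Since \<open>q * (1 - e) = p\<close>, its
  \<open>q\<close>-th power is controlled by the \<open>p\<close>-th power of the maximal function,
  and the Morrey bound for the latter finishes the proof.\<close>

lemma commutator_bounded_of_hoelder:
  fixes b g :: "'a::euclidean_space \<Rightarrow> real" and p q lam \<beta> :: real
  assumes g: "g \<in> lipschitz_space \<beta>" "AE x in lebesgue. b x = g x" and b0: "AE x in lebesgue. 0 \<le> b x"
    and \<beta>: "0 < \<beta>" and p: "1 < p" and lam: "lam < DIM('a) - \<beta> * p"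
    and q: "1 / q = 1 / p - \<beta> / (DIM('a) - lam)"
  shows "commutator_bounded b p lam q lam"
proof -
  define e where "e = p * \<beta> / (DIM('a) - lam)"
  have n: "real DIM('a) - lam > 0" using lam p \<beta> by (smt (verit) mult_pos_pos)
  have e01: "0 < e" "e < 1" using lam p \<beta> n by (auto simp: e_def field_simps)
  have "1 / q = (1 - e) / p" using p n unfolding q e_def by (simp add: field_simps)
  hence "1 / (1 / q) = 1 / ((1 - e) / p)" by (rule arg_cong)
  hence pq: "q = p / (1 - e)" by simp
  have qpos: "q > 0" using pq p e01 by simp
  have qe: "q * (1 - e) = p" using pq e01 by simp
  obtain C0 where C0: "\<And>x y. \<bar>g x - g y\<bar> \<le> C0 * norm (x - y) powr \<beta>"
    using g(1) unfolding lipschitz_space_def by blast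
  define C where "C = \<bar>C0\<bar>"
  have C: "C \<ge> 0" "\<bar>g x - g y\<bar> \<le> C * norm (x - y) powr \<beta>" for x y
  proof -
    show "\<bar>g x - g y\<bar> \<le> C * norm (x - y) powr \<beta>"
      by (rule order_trans[OF C0]) (auto simp: C_def intro!: mult_right_mono)
  qed (simp add: C_def)
  have g_meas [measurable]: "g \<in> borel_measurable lebesgue"
    using borel_measurable_hoelder[OF C(2) \<beta>] .
  have "lam < DIM('a)" using n by simp
  then obtain A where A: "A \<ge> 0" "\<And>(f::'a \<Rightarrow> real) F a l. f \<in> borel_measurable lebesgue \<Longrightarrow> F \<ge> 0 \<Longrightarrow>
    (\<And>a l. l > 0 \<Longrightarrow> (\<integral>\<^sup>+x\<in>cube a l. ennreal (\<bar>f x\<bar> powr p) \<partial>lebesgue) \<le> ennreal (F powr p * l powr lam)) \<Longrightarrow>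
    l > 0 \<Longrightarrow> (\<integral>\<^sup>+x\<in>cube a l. enn_powr (hl_max f x) p \<partial>lebesgue) \<le> ennreal (A * F powr p * l powr lam)"
    using hl_max_morrey[OF p] by blast
  define D where "D = C * DIM('a) powr \<beta> * 2 powr e"
  have D: "D \<ge> 0" using C by (simp add: D_def)
  \<comment> \<open>\<open>D\<close> stems from the pointwise bound, \<open>A powr (1 / q)\<close>
    from the maximal function.\<close>
  define K where "K = D * A powr (1 / q)"
  have K: "K \<ge> 0" using D by (simp add: K_def)
  show ?thesis
    unfolding commutator_bounded_def
  proof (intro exI[of _ K] conjI K ballI)
    fix f :: "'a \<Rightarrow> real" assume "f \<in> morrey_space p lam"
    hence f [measurable]: "f \<in> borel_measurable lebesgue"
      and fin: "morrey_norm p lam (\<lambda>x. ereal (f x)) < \<infinity>"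
      by (auto simp: morrey_space_def)
    obtain F where F: "morrey_norm p lam (\<lambda>x. ereal (f x)) = ennreal F" "F \<ge> 0"
      using fin by (cases "morrey_norm p lam (\<lambda>x. ereal (f x))") auto
    have morrey: "(\<integral>\<^sup>+x\<in>cube a l. ennreal (\<bar>f x\<bar> powr p) \<partial>lebesgue) \<le> ennreal (F powr p * l powr lam)"
      if "l > 0" for a l
      using morrey_norm_le_iff[of p F lam "\<lambda>x. ereal (f x)"] p F that by (simp add: enn_powr_ennreal)
    have Mf: "(\<integral>\<^sup>+x\<in>cube a l. enn_powr (hl_max f x) p \<partial>lebesgue) \<le> ennreal (A * F powr p * l powr lam)"
      if "l > 0" for a l
      by (intro A f F morrey that)
    have Mf_fin: "AE x in lebesgue. hl_max f x \<noteq> top"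
      by (rule hl_max_morrey_finite_AE[where p = p]) (rule le_less_trans[OF Mf], auto)
    \<comment> \<open>The integrals in the maximal function ignore null sets, so this holds at every
      \<open>x\<close>, whereas \<open>b x = g x\<close> itself holds only almost
      everywhere.\<close>
    have bg: "hl_max (\<lambda>y. b y * f y) x = hl_max (\<lambda>y. g y * f y) x" for x
    proof -
      have "(\<integral>\<^sup>+y\<in>Q. ennreal \<bar>b y * f y\<bar> \<partial>lebesgue) = (\<integral>\<^sup>+y\<in>Q. ennreal \<bar>g y * f y\<bar> \<partial>lebesgue)" for Q
        by (rule nn_integral_cong_AE) (use g(2) in \<open>auto elim!: eventually_mono\<close>)
      thus ?thesis unfolding hl_max_def by simp
    qed
    have AE: "AE x in lebesgue. hl_max f x \<noteq> top \<and>
      enn_powr (e2ennreal \<bar>commutator b f x\<bar>) q \<le> ennreal ((D * F powr e) powr q) * enn_powr (hl_max f x) p"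
      using Mf_fin g(2) b0
    proof eventually_elim
      case (elim x)
      then obtain m where m: "hl_max f x = ennreal m" "m \<ge> 0" by (cases "hl_max f x") auto
      have gx: "b x = g x" "g x \<ge> 0" using elim by auto
      define S where "S = C * DIM('a) powr \<beta> * (m powr (1 - e) * (2 * F) powr e)"
      have S: "S \<ge> 0" using C by (simp add: S_def)
      have osc: "(\<integral>\<^sup>+y\<in>cube a l. ennreal (\<bar>g y - g x\<bar> * \<bar>f y\<bar>) \<partial>lebesgue) \<le> ennreal S * ennreal (l ^ DIM('a))"
        if "l > 0" "x \<in> cube a l" for a l
        unfolding S_def by (rule cube_oscillation_le[OF f C p \<beta> lam m F(2) morrey that(2,1) e_def])
      have "e2ennreal \<bar>commutator b f x\<bar> \<le> ennreal S"
        by (rule commutator_abs_le[OF m S]) (use gx hl_max_mult_close[OF f g_meas m gx(2) S osc] bg in auto)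
      hence "enn_powr (e2ennreal \<bar>commutator b f x\<bar>) q \<le> enn_powr (ennreal S) q"
        using qpos by (intro enn_powr_mono) auto
      also have "\<dots> = ennreal (S powr q)" using S by (simp add: enn_powr_ennreal)
      also have "S = D * F powr e * m powr (1 - e)" using F by (simp add: S_def D_def powr_mult)
      also have "\<dots> powr q = (D * F powr e) powr q * m powr p"
        using D qe by (simp add: powr_mult powr_powr mult.commute)
      also have "ennreal \<dots> = ennreal ((D * F powr e) powr q) * enn_powr (hl_max f x) p"
        using m by (simp add: enn_powr_ennreal ennreal_mult)
      finally show ?case using elim by simp
    qed
    show "AE x in lebesgue. commutator_well_defined b f x"
      using AE
    proof eventually_elim
      case (elim x)
      then obtain m where "hl_max f x = ennreal m" "m \<ge> 0" by (cases "hl_max f x") auto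
      thus ?case by (simp add: commutator_well_defined_def)
    qed
    have "morrey_norm q lam (commutator b f) \<le> ennreal (K * F)"
    proof (subst morrey_norm_le_iff)
      show "\<forall>a l. l > 0 \<longrightarrow> (\<integral>\<^sup>+x\<in>cube a l. enn_powr (e2ennreal \<bar>commutator b f x\<bar>) q \<partial>lebesgue)
        \<le> ennreal ((K * F) powr q * l powr lam)"
      proof (intro allI impI)
        fix a :: 'a and l :: real assume l: "l > 0"
        have "(\<integral>\<^sup>+x\<in>cube a l. enn_powr (e2ennreal \<bar>commutator b f x\<bar>) q \<partial>lebesgue)
          \<le> (\<integral>\<^sup>+x. ennreal ((D * F powr e) powr q) * (enn_powr (hl_max f x) p * indicator (cube a l) x) \<partial>lebesgue)"
          by (rule nn_integral_mono_AE, rule eventually_mono[OF AE]) (auto simp: indicator_def)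
        also have "\<dots> = ennreal ((D * F powr e) powr q) * (\<integral>\<^sup>+x\<in>cube a l. enn_powr (hl_max f x) p \<partial>lebesgue)"
          by (subst nn_integral_cmult) auto
        also have "\<dots> \<le> ennreal ((D * F powr e) powr q) * ennreal (A * F powr p * l powr lam)"
          by (intro mult_left_mono Mf l) simp
        also have "\<dots> = ennreal ((D * F powr e) powr q * (A * F powr p * l powr lam))"
          using A by (simp add: ennreal_mult)
        also have "(D * F powr e) powr q * (A * F powr p * l powr lam) = (K * F) powr q * l powr lam"
        proof -
          \<comment> \<open>The powers of \<open>F\<close> recombine to make the final estimate
            linear in the norm of \<open>f\<close>.\<close>
          have "F powr (e * q) * F powr p = F powr q"
          proof -
            have "e * q + p = q" using qe by (simp add: algebra_simps)
            thus ?thesis by (simp flip: powr_add)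
          qed
          moreover have "(A powr (1 / q)) powr q = A" using A qpos by (simp add: powr_powr)
          ultimately show ?thesis
            using D F A by (simp add: K_def powr_mult powr_powr mult_ac)
        qed
        finally show "(\<integral>\<^sup>+x\<in>cube a l. enn_powr (e2ennreal \<bar>commutator b f x\<bar>) q \<partial>lebesgue)
          \<le> ennreal ((K * F) powr q * l powr lam)" .
      qed
    qed (use qpos K F in auto)
    thus "morrey_norm q lam (commutator b f) \<le> ennreal K * morrey_norm p lam (\<lambda>x. ereal (f x))"
      using F K by (simp add: ennreal_mult)
  qed
qed

section \<open>Boundedness implies Hoelder continuity\<close>

text \<open>The intersection of the two cubes has volume at most the power \<open>DIM('a)\<close> of
  the smaller side. Split the exponent as \<open>(DIM('a) - lam) + lam\<close> and estimate the
  smaller side by \<open>l\<close> in one factor and by \<open>r\<close> in the other.\<close>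

lemma morrey_norm_indicator_cube:
  fixes a :: "'a::euclidean_space" and p lam :: real
  assumes p: "p > 0" and lam: "0 \<le> lam" "lam \<le> DIM('a)" and l: "l > 0"
  shows "morrey_norm p lam (\<lambda>x. ereal (indicator (cube a l) x)) \<le> ennreal (l powr ((DIM('a) - lam) / p))"
proof (subst morrey_norm_le_iff[OF p]; (intro allI impI)?)
  fix a' :: 'a and r :: real assume r: "r > 0"
  have "(\<integral>\<^sup>+x\<in>cube a' r. enn_powr (e2ennreal \<bar>ereal (indicator (cube a l) x)\<bar>) p \<partial>lebesgue)
      = (\<integral>\<^sup>+x. indicator (cube a l \<inter> cube a' r) x \<partial>lebesgue)"
    using p by (intro nn_integral_cong) (auto simp: indicator_def enn_powr_def)
  also have "\<dots> = emeasure lebesgue (cube a l \<inter> cube a' r)"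
    by (intro nn_integral_indicator) auto
  also have "\<dots> \<le> ennreal (l powr (DIM('a) - lam) * r powr lam)"
  proof (cases "r \<le> l")
    case True
    have "emeasure lebesgue (cube a l \<inter> cube a' r) \<le> emeasure lebesgue (cube a' r)"
      by (intro emeasure_mono) auto
    also have "\<dots> = ennreal (r powr (DIM('a) - lam) * r powr lam)"
      using r by (subst emeasure_cube) (auto simp: powr_realpow simp flip: powr_add)
    also have "\<dots> \<le> ennreal (l powr (DIM('a) - lam) * r powr lam)"
      using True r lam by (intro ennreal_leI mult_right_mono powr_mono2) auto
    finally show ?thesis .
  next
    case False
    have "emeasure lebesgue (cube a l \<inter> cube a' r) \<le> emeasure lebesgue (cube a l)"
      by (intro emeasure_mono) auto
    also have "\<dots> = ennreal (l powr (DIM('a) - lam) * l powr lam)"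
      using l by (subst emeasure_cube) (auto simp: powr_realpow simp flip: powr_add)
    also have "\<dots> \<le> ennreal (l powr (DIM('a) - lam) * r powr lam)"
      using False l lam by (intro ennreal_leI mult_left_mono powr_mono2) auto
    finally show ?thesis .
  qed
  also have "l powr (DIM('a) - lam) = (l powr ((DIM('a) - lam) / p)) powr p"
    using p by (simp add: powr_powr)
  finally show "(\<integral>\<^sup>+x\<in>cube a' r. enn_powr (e2ennreal \<bar>ereal (indicator (cube a l) x)\<bar>) p \<partial>lebesgue)
      \<le> ennreal ((l powr ((DIM('a) - lam) / p)) powr p * r powr lam)" .
qed simp

lemma indicator_cube_in_morrey_space:
  fixes a :: "'a::euclidean_space" and p lam :: real
  assumes p: "p > 0" and lam: "0 \<le> lam" "lam \<le> DIM('a)" and l: "l > 0"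
  shows "indicator (cube a l) \<in> morrey_space p lam"
proof -
  have "(\<lambda>x. \<bar>indicator (cube a l) x :: real\<bar> powr p) = indicator (cube a l)"
    using p by (auto simp: indicator_def)
  moreover have "locally_integrable (indicator (cube a l) :: 'a \<Rightarrow> real)"
    unfolding locally_integrable_def
  proof (intro allI impI)
    fix K :: "'a set" assume "compact K"
    hence "K \<inter> cube a l \<in> lmeasurable" by (intro lmeasurable_compact compact_Int compact_cbox)
    hence "integrable lebesgue (indicator (K \<inter> cube a l) :: 'a \<Rightarrow> real)"
      by (simp add: lmeasurable_iff_integrable)
    also have "(indicator (K \<inter> cube a l) :: 'a \<Rightarrow> real) = (\<lambda>x. indicator K x *\<^sub>R indicator (cube a l) x)"
      by (auto simp: indicator_def)
    finally show "(indicator (cube a l) :: 'a \<Rightarrow> real) absolutely_integrable_on K"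
      unfolding set_integrable_def .
  qed
  moreover have "morrey_norm p lam (\<lambda>x. ereal (indicator (cube a l) x)) < \<infinity>"
    using le_less_trans[OF morrey_norm_indicator_cube[OF assms]] by simp
  ultimately show ?thesis unfolding morrey_space_def by simp
qed

section \<open>Testing the commutator on the indicator of a cube\<close>

lemma hl_max_indicator_cube:
  fixes a :: "'a::euclidean_space"
  assumes l: "l > 0" and x: "x \<in> cube a l"
  shows "hl_max (indicator (cube a l)) x = 1"
proof (rule antisym)
  show "hl_max (indicator (cube a l)) x \<le> 1"
    unfolding hl_max_le_iff
  proof safe
    fix a' :: 'a and r :: real assume r: "r > 0"
    have "(\<integral>\<^sup>+y\<in>cube a' r. ennreal \<bar>indicator (cube a l) y\<bar> \<partial>lebesgue) \<le> (\<integral>\<^sup>+y. indicator (cube a' r) y \<partial>lebesgue)"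
      by (intro nn_integral_mono) (auto simp: indicator_def)
    also have "\<dots> = emeasure lebesgue (cube a' r)" by (intro nn_integral_indicator) auto
    also have "\<dots> = 1 * ennreal (r ^ DIM('a))" using r by (subst emeasure_cube) auto
    finally show "(\<integral>\<^sup>+y\<in>cube a' r. ennreal \<bar>indicator (cube a l) y\<bar> \<partial>lebesgue) \<le> 1 * ennreal (r ^ DIM('a))" .
  qed
  have "ennreal (l ^ DIM('a)) = emeasure lebesgue (cube a l)" using l by (subst emeasure_cube) auto
  also have "\<dots> = (\<integral>\<^sup>+y. indicator (cube a l) y \<partial>lebesgue)" by (intro nn_integral_indicator[symmetric]) auto
  also have "\<dots> = (\<integral>\<^sup>+y\<in>cube a l. ennreal \<bar>indicator (cube a l) y\<bar> \<partial>lebesgue)"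
    by (intro nn_integral_cong) (auto simp: indicator_def)
  also have "\<dots> \<le> hl_max (indicator (cube a l)) x * ennreal (l ^ DIM('a))"
    by (rule cube_average_le_hl_max[OF l x])
  finally have "ennreal (l ^ DIM('a)) / ennreal (l ^ DIM('a)) \<le> hl_max (indicator (cube a l)) x"
    using l by (subst divide_le_ennreal_iff) auto
  thus "1 \<le> hl_max (indicator (cube a l)) x" using l by simp
qed

text \<open>On the cube the commutator is \<open>b x - ?H\<close>, and the cube itself is a
  competitor in \<open>?H\<close>, so \<open>c\<close> is at most \<open>?H\<close>. The truncation
  in \<open>ennreal\<close> makes this a bound on the positive part of
  \<open>c - b x\<close>.\<close>

lemma commutator_indicator_cube_ge:
  fixes b :: "'a::euclidean_space \<Rightarrow> real"
  assumes l: "l > 0" and x: "x \<in> cube a l"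
    and c: "ennreal c * ennreal (l ^ DIM('a)) \<le> (\<integral>\<^sup>+y\<in>cube a l. ennreal \<bar>b y\<bar> \<partial>lebesgue)"
  shows "ennreal (c - b x) \<le> e2ennreal \<bar>commutator b (indicator (cube a l)) x\<bar>"
proof -
  let ?H = "hl_max (\<lambda>y. b y * indicator (cube a l) y) x"
  note c
  also have "(\<integral>\<^sup>+y\<in>cube a l. ennreal \<bar>b y\<bar> \<partial>lebesgue) =
      (\<integral>\<^sup>+y\<in>cube a l. ennreal \<bar>b y * indicator (cube a l) y\<bar> \<partial>lebesgue)"
    by (intro nn_integral_cong) (auto simp: indicator_def)
  also have "\<dots> \<le> ?H * ennreal (l ^ DIM('a))" by (rule cube_average_le_hl_max[OF l x])
  finally have "ennreal c * ennreal (l ^ DIM('a)) / ennreal (l ^ DIM('a)) \<le> ?H"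
    using l by (subst divide_le_ennreal_iff) auto
  hence cH: "ennreal c \<le> ?H" using l by (simp add: ennreal_mult_divide_eq)
  have comm: "commutator b (indicator (cube a l)) x = ereal (b x) - enn2ereal ?H"
    unfolding commutator_def hl_max_indicator_cube[OF l x] by (simp add: one_ennreal.rep_eq)
  show ?thesis
  proof (cases ?H)
    case (real h)
    have "c \<le> h"
      \<comment> \<open>For negative \<open>c\<close> the hypothesis carries no information, but
        then \<open>c \<le> h\<close> because \<open>h\<close> is nonnegative.\<close>
      using cH real by (cases "c \<ge> 0") auto
    thus ?thesis using real by (simp add: comm ennreal_leI flip: ennreal.rep_eq)
  next
    case top
    \<comment> \<open>Here the commutator is minus infinity, so its absolute value is
      infinite.\<close>
    thus ?thesis by (simp add: comm flip: top_ennreal.rep_eq)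
  qed
qed

text \<open>The Morrey bound on the cube alone controls the \<open>q\<close>-th power of the
  positive part of \<open>c - b\<close>, and the Hoelder substitute turns this into a bound on its
  integral, at the cost of the factor 2. The constant does not depend on \<open>c\<close>.\<close>

lemma commutator_bounded_imp_oscillation:
  fixes b :: "'a::euclidean_space \<Rightarrow> real" and p q lam \<beta> :: real
  assumes b: "locally_integrable b" and p: "p > 0" and q: "q > 1"
    and lam: "0 \<le> lam" "lam \<le> DIM('a)" and \<beta>: "\<beta> = (DIM('a) - lam) * (1 / p - 1 / q)"
    and bounded: "commutator_bounded b p lam q lam"
  obtains K where "K \<ge> 0" "\<And>a l c. l > 0 \<Longrightarrow>
    ennreal c * ennreal (l ^ DIM('a)) \<le> (\<integral>\<^sup>+y\<in>cube a l. ennreal \<bar>b y\<bar> \<partial>lebesgue) \<Longrightarrow>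
    integral (cube a l) (\<lambda>x. max 0 (c - b x)) \<le> K * l powr (DIM('a) + \<beta>)"
proof -
  obtain C where C: "C \<ge> 0" "\<And>f. f \<in> morrey_space p lam \<Longrightarrow>
      morrey_norm q lam (commutator b f) \<le> ennreal C * morrey_norm p lam (\<lambda>x. ereal (f x))"
    using bounded unfolding commutator_bounded_def by blast
  show ?thesis
  proof (rule that[of "2 * C"])
    fix a :: 'a and l c :: real
    assume l: "l > 0" and c: "ennreal c * ennreal (l ^ DIM('a)) \<le> (\<integral>\<^sup>+y\<in>cube a l. ennreal \<bar>b y\<bar> \<partial>lebesgue)"
    let ?Q = "cube a l" and ?f = "indicator (cube a l) :: 'a \<Rightarrow> real"
    have "morrey_norm q lam (commutator b ?f) \<le> ennreal C * morrey_norm p lam (\<lambda>x. ereal (?f x))"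
      by (intro C indicator_cube_in_morrey_space p lam l)
    also have "\<dots> \<le> ennreal C * ennreal (l powr ((DIM('a) - lam) / p))"
      by (intro mult_left_mono morrey_norm_indicator_cube p lam l) simp
    also have "\<dots> = ennreal (C * l powr ((DIM('a) - lam) / p))" using C by (simp add: ennreal_mult)
    finally have comm: "(\<integral>\<^sup>+x\<in>?Q. enn_powr (e2ennreal \<bar>commutator b ?f x\<bar>) q \<partial>lebesgue)
        \<le> ennreal ((C * l powr ((DIM('a) - lam) / p)) powr q * l powr lam)"
      using q C l by (subst (asm) morrey_norm_le_iff) auto
    \<comment> \<open>The exponent count that makes \<open>\<beta>\<close> appear: the norm of the
      indicator together with the weight \<open>l powr lam\<close> amounts to
      \<open>l powr (\<beta> * q)\<close> times the volume.\<close>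
    have "(DIM('a) - lam) / p * q + lam = \<beta> * q + DIM('a)"
      using p q by (simp add: \<beta> field_simps)
    hence "l powr ((DIM('a) - lam) / p * q) * l powr lam = l powr (\<beta> * q) * l ^ DIM('a)"
      using l by (simp add: powr_realpow[symmetric] flip: powr_add)
    hence eq: "(C * l powr ((DIM('a) - lam) / p)) powr q * l powr lam = (C * l powr \<beta>) powr q * l ^ DIM('a)"
      using C by (simp add: powr_mult powr_powr mult.assoc)
    have bQ: "b absolutely_integrable_on ?Q" by (rule locally_integrable_cbox[OF b])
    hence [measurable]: "(\<lambda>x. indicator ?Q x *\<^sub>R b x) \<in> borel_measurable lebesgue"
      unfolding set_integrable_def by (rule borel_measurable_integrable)
    \<comment> \<open>Agrees with the positive part of \<open>c - b\<close> on the cube. The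
      indicators make it measurable on the whole space from the integrability of \<open>b\<close> on
      the cube.\<close>
    define u where "u x = ennreal (c * indicator ?Q x - indicator ?Q x *\<^sub>R b x)" for x
    have [measurable]: "u \<in> borel_measurable lebesgue" unfolding u_def by measurable
    have u_eq: "u x = ennreal (c - b x)" if "x \<in> ?Q" for x using that by (simp add: u_def)
    have int: "(\<lambda>x. max 0 (c - b x)) integrable_on ?Q"
      by (intro set_lebesgue_integral_eq_integral(1) absolutely_integrable_max_1 set_integral_diff(1) bQ
          absolutely_integrable_on_const) auto
    have "ennreal (integral ?Q (\<lambda>x. max 0 (c - b x))) = (\<integral>\<^sup>+x\<in>?Q. ennreal (max 0 (c - b x)) \<partial>lebesgue)"
      by (rule set_nn_integral_eq_integral[symmetric]) (use int in auto)
    also have "\<dots> = (\<integral>\<^sup>+x\<in>?Q. u x \<partial>lebesgue)"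
      by (intro nn_integral_cong) (auto simp: u_eq max_def ennreal_neg indicator_def)
    also have "\<dots> \<le> ennreal (2 * (C * l powr \<beta>) * l ^ DIM('a))"
    proof (rule set_nn_integral_le_of_powr[where p = q])
      have "(\<integral>\<^sup>+x\<in>?Q. enn_powr (u x) q \<partial>lebesgue) \<le> (\<integral>\<^sup>+x\<in>?Q. enn_powr (e2ennreal \<bar>commutator b ?f x\<bar>) q \<partial>lebesgue)"
        using commutator_indicator_cube_ge[OF l _ c] q
        by (intro nn_integral_mono) (auto simp: u_eq indicator_def intro!: enn_powr_mono)
      also note comm
      finally show "(\<integral>\<^sup>+x\<in>?Q. enn_powr (u x) q \<partial>lebesgue) \<le> ennreal ((C * l powr \<beta>) powr q * l ^ DIM('a))"
        unfolding eq .
      show "emeasure lebesgue ?Q = ennreal (l ^ DIM('a))" using l by (intro emeasure_cube) simp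
    qed (use q C l in auto)
    also have "2 * (C * l powr \<beta>) * l ^ DIM('a) = 2 * C * l powr (DIM('a) + \<beta>)"
      using l by (simp add: powr_add powr_realpow)
    finally show "integral ?Q (\<lambda>x. max 0 (c - b x)) \<le> 2 * C * l powr (DIM('a) + \<beta>)"
      using C by (subst (asm) ennreal_le_iff) auto
  qed (use C in simp)
qed

lemma hoelder_of_commutator_bounded:
  fixes b :: "'a::euclidean_space \<Rightarrow> real" and p q lam \<beta> :: real
  assumes b: "locally_integrable b" and p: "p > 0" and q: "q > 1"
    and lam: "0 \<le> lam" "lam \<le> DIM('a)" and \<beta>: "\<beta> = (DIM('a) - lam) * (1 / p - 1 / q)" "0 < \<beta>" "\<beta> \<le> 1"
    and bounded: "commutator_bounded b p lam q lam"
  shows "\<exists>g\<in>lipschitz_space \<beta>. AE x in lebesgue. b x = g x" and "AE x in lebesgue. 0 \<le> b x"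
proof -
  obtain K where K: "K \<ge> 0" "\<And>a l c. l > 0 \<Longrightarrow>
    ennreal c * ennreal (l ^ DIM('a)) \<le> (\<integral>\<^sup>+y\<in>cube a l. ennreal \<bar>b y\<bar> \<partial>lebesgue) \<Longrightarrow>
    integral (cube a l) (\<lambda>x. max 0 (c - b x)) \<le> K * l powr (DIM('a) + \<beta>)"
    using commutator_bounded_imp_oscillation[OF b p q lam \<beta>(1) bounded] by blast
  show "AE x in lebesgue. 0 \<le> b x"
  proof (rule AE_nonneg_of_cube_integrals[OF b \<beta>(2) K(1)])
    fix a :: 'a and l :: real assume "l > 0"
    thus "integral (cube a l) (\<lambda>x. max 0 (- b x)) \<le> K * l powr (DIM('a) + \<beta>)"
      \<comment> \<open>With \<open>c = 0\<close> the condition on \<open>c\<close> is trivial and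
        the integrand is the negative part of \<open>b\<close>.\<close>
      using K(2)[of l 0 a] by simp
  qed
  show "\<exists>g\<in>lipschitz_space \<beta>. AE x in lebesgue. b x = g x"
  proof (rule campanato[OF b \<beta>(2,3)])
    show "2 * K \<ge> 0" using K by simp
    fix a :: 'a and l :: real assume l: "l > 0"
    define c where "c = cube_avg b a l"
    have babs: "b absolutely_integrable_on cube a l" by (rule locally_integrable_cbox[OF b])
    hence bi: "b integrable_on cube a l" "(\<lambda>x. \<bar>b x\<bar>) integrable_on cube a l"
      unfolding absolutely_integrable_on_def by auto
    have mi: "(\<lambda>x. max 0 (c - b x)) integrable_on cube a l"
      by (intro set_lebesgue_integral_eq_integral(1) absolutely_integrable_max_1 set_integral_diff(1) babs
          absolutely_integrable_on_const) auto
    have cl: "c * l ^ DIM('a) = integral (cube a l) b" using l by (simp add: c_def cube_avg_def)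
    have "c * l ^ DIM('a) \<le> integral (cube a l) (\<lambda>x. \<bar>b x\<bar>)"
      unfolding cl by (rule integral_le) (use bi in auto)
    hence "ennreal c * ennreal (l ^ DIM('a)) \<le> ennreal (integral (cube a l) (\<lambda>x. \<bar>b x\<bar>))"
      using l by (simp add: ennreal_leI flip: ennreal_mult'')
    also have "\<dots> = (\<integral>\<^sup>+y\<in>cube a l. ennreal \<bar>b y\<bar> \<partial>lebesgue)"
      by (rule set_nn_integral_eq_integral[symmetric]) (use bi in auto)
    finally have neg: "integral (cube a l) (\<lambda>x. max 0 (c - b x)) \<le> K * l powr (DIM('a) + \<beta>)"
      by (rule K(2)[OF l])
    \<comment> \<open>A real number's absolute value is itself plus twice its negative part, and
      \<open>b - c\<close> has integral 0 over the cube.\<close>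
    have "integral (cube a l) (\<lambda>x. \<bar>b x - c\<bar>) = integral (cube a l) (\<lambda>x. 2 * max 0 (c - b x) + (b x - c))"
      by (intro integral_cong) (auto simp: max_def)
    also have "\<dots> = 2 * integral (cube a l) (\<lambda>x. max 0 (c - b x)) + (integral (cube a l) b - c * l ^ DIM('a))"
    proof -
      have "integral (cube a l) (\<lambda>x. b x - c) = integral (cube a l) b - c * l ^ DIM('a)"
        using l bi measure_cube[of l a] by (subst integral_diff) auto
      thus ?thesis using mi bi
        by (subst integral_add) (auto intro!: integrable_diff)
    qed
    also have "\<dots> = 2 * integral (cube a l) (\<lambda>x. max 0 (c - b x))" using cl by simp
    also have "\<dots> \<le> 2 * K * l powr (DIM('a) + \<beta>)" using neg by simp
    finally show "integral (cube a l) (\<lambda>x. \<bar>b x - cube_avg b a l\<bar>) \<le> 2 * K * l powr (DIM('a) + \<beta>)"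
      unfolding c_def .
  qed
qed

theorem theorem1p6:
  fixes b :: "real ^ 'n \<Rightarrow> real" and \<beta> p q lam :: real
  assumes "locally_integrable b"
    and "0 < \<beta>" and "\<beta> < 1"
    and "1 < p" and "p < real CARD('n) / \<beta>"
    and "0 < lam" and "lam < real CARD('n) - \<beta> * p"
    and "1 / q = 1 / p - \<beta> / (real CARD('n) - lam)"
  shows "((\<exists>g \<in> lipschitz_space \<beta>. AE x in lebesgue. b x = g x) \<and> (AE x in lebesgue. 0 \<le> b x))
    \<longleftrightarrow> commutator_bounded b p lam q lam"
proof
  assume "(\<exists>g \<in> lipschitz_space \<beta>. AE x in lebesgue. b x = g x) \<and> (AE x in lebesgue. 0 \<le> b x)"
  then obtain g where "g \<in> lipschitz_space \<beta>" "AE x in lebesgue. b x = g x" "AE x in lebesgue. 0 \<le> b x"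
    by blast
  thus "commutator_bounded b p lam q lam"
    by (rule commutator_bounded_of_hoelder) (use assms in auto)
next
  assume bounded: "commutator_bounded b p lam q lam"
  have "\<beta> * p > 0" using assms by simp
  hence n: "real CARD('n) - lam > 0" using assms(7) by linarith
  have \<beta>: "\<beta> = (DIM(real ^ 'n) - lam) * (1 / p - 1 / q)" using n unfolding assms(8) by simp
  \<comment> \<open>The condition \<open>lam < CARD('n) - \<beta> * p\<close> says exactly that
    \<open>1 / q\<close> is positive; \<open>q > 1\<close> then follows from
    \<open>q > p\<close>.\<close>
  have "\<beta> / (real CARD('n) - lam) < 1 / p" using n assms(4,7) by (simp add: field_simps)
  hence "1 / q > 0" unfolding assms(8) by simp
  hence q0: "q > 0" by simp
  have "1 / q < 1 / p" unfolding assms(8) using n \<open>0 < \<beta>\<close> by simp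
  hence "q > 1" using q0 \<open>1 < p\<close> by (simp add: field_simps)
  from hoelder_of_commutator_bounded[OF assms(1) _ this _ _ \<beta> _ _ bounded]
  show "(\<exists>g \<in> lipschitz_space \<beta>. AE x in lebesgue. b x = g x) \<and> (AE x in lebesgue. 0 \<le> b x)"
    using assms n by simp
qed

end
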